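(* Let $N,r\in\mathbb{N}$, $f\in C^r(\mathbb{R}^N)$ and $\mathbf{x},\mathbf{u}\in\mathbb{R}^N$. Let $R_r(f;\mathbf{x},\mathbf{u})$ be the remainder of the Taylor formula of order $r$, $$R_r(f;\mathbf{x},\mathbf{u})=f(\mathbf{u})-f(\mathbf{x})-\sum_{\nu=1}^r\sum_{|\mathbf{h}|=\nu}\frac{D^{\mathbf{h}}f(\mathbf{x})}{\mathbf{h}!}(\mathbf{u}-\mathbf{x})^{\mathbf{h}}.$$ Then $$|R_r(f;\mathbf{x},\mathbf{u})|\le\frac{2}{r!}\sum_{i_1=1}^N\sum_{i_2=1}^N\cdots\sum_{i_r=1}^N|u_{i_1}-x_{i_1}|^r\,K\Big(\frac{N}{2(r+1)}|u_{i_1}-x_{i_1}|,\ \frac{\partial^r f}{\partial x_{i_1}\cdots\partial x_{i_r}}\Big).$$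
   Context: $\mathbb{N}$ is the set of positive integers and $\mathbb{N}_0$ the non-negative integers. For $\mathbf{h}\in\mathbb{N}_0^N$: $|\mathbf{h}|=h_1+\dots+h_N$, $\mathbf{h}!=\prod_i h_i!$, $\mathbf{x}^{\mathbf{h}}=\prod_i x_i^{h_i}$, $D^{\mathbf{h}}f=\partial^{|\mathbf{h}|}f/\partial x_1^{h_1}\cdots\partial x_N^{h_N}$; sums $\sum_{|\mathbf{h}|=\nu}$ run over $\mathbf{h}\in\mathbb{N}_0^N$. $C^0=C^0(\mathbb{R}^N)$ is the space of bounded uniformly continuous functions $\mathbb{R}^N\to\mathbb{R}$; for $\nu\ge1$, $C^\nu=C^\nu(\mathbb{R}^N)$ is the subspace of $C^0$ whose elements are $\nu$-times continuously differentiable with $\nu$-th order derivatives in $C^0$. $\|\cdot\|_\infty$ is the sup norm. Peetre K-functional: for $F\in C^0$ and $\varepsilon\ge0$, $K(\varepsilon,F)=\inf\{\|F-g\|_\infty+\varepsilon\max_{i=1,\dots,N}\|\partial g/\partial x_i\|_\infty:\ g\in C^1\}$. *)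

theory Defs
  imports "HOL-Analysis.Analysis"
begin

text \<open>
  Euclidean space of dimension \<open>N\<close> is \<^typ>\<open>real ^ 'n\<close> with \<open>N = CARD('n)\<close>; the linear order on
  \<open>'n\<close> is the order of the coordinates \<open>x\<^sub>1, \<dots>, x\<^sub>N\<close>, which fixes the order of differentiation in \<open>D_multi\<close>.
\<close>

definition partial_deriv :: "'n::finite \<Rightarrow> (real ^ 'n \<Rightarrow> real) \<Rightarrow> real ^ 'n \<Rightarrow> real" where
  "partial_deriv i f x = deriv (\<lambda>t. f (x + t *\<^sub>R axis i 1)) 0"

definition iter_partial :: "'n::finite list \<Rightarrow> (real ^ 'n \<Rightarrow> real) \<Rightarrow> real ^ 'n \<Rightarrow> real" where
  "iter_partial is f = foldr partial_deriv is f"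

definition D_multi :: "('n::{finite,linorder} \<Rightarrow> nat) \<Rightarrow> ((real, 'n) vec \<Rightarrow> real) \<Rightarrow> (real, 'n) vec \<Rightarrow> real" where
  "D_multi h f = foldr (\<lambda>i. partial_deriv i ^^ h i) (sorted_list_of_set UNIV) f"

definition C0 :: "(real ^ 'n::finite \<Rightarrow> real) set" where
  "C0 = {f. uniformly_continuous_on UNIV f \<and> bounded (range f)}"

primrec times_cont_diff :: "nat \<Rightarrow> (real ^ 'n::finite \<Rightarrow> real) \<Rightarrow> bool" where
  "times_cont_diff 0 f \<longleftrightarrow> continuous_on UNIV f"
| "times_cont_diff (Suc k) f \<longleftrightarrow>
     (\<forall>x. f differentiable (at x)) \<and> (\<forall>i. times_cont_diff k (partial_deriv i f))"

text \<open>Only the derivatives of order exactly \<open>\<nu>\<close> are required to lie in \<^const>\<open>C0\<close>; \<open>C_space 0 = C0\<close>.\<close>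

definition C_space :: "nat \<Rightarrow> (real ^ 'n::finite \<Rightarrow> real) set" where
  "C_space \<nu> = {f \<in> C0. times_cont_diff \<nu> f \<and> (\<forall>is. length is = \<nu> \<longrightarrow> iter_partial is f \<in> C0)}"

definition sup_norm :: "(real ^ 'n::finite \<Rightarrow> real) \<Rightarrow> real" where
  "sup_norm f = (SUP x. \<bar>f x\<bar>)"

definition K_functional :: "real \<Rightarrow> (real ^ 'n::finite \<Rightarrow> real) \<Rightarrow> real" where
  "K_functional \<epsilon> F =
     (INF g \<in> C_space 1. sup_norm (\<lambda>x. F x - g x) + \<epsilon> * (MAX i. sup_norm (partial_deriv i g)))"

definition taylor_remainder ::
    "nat \<Rightarrow> ((real, 'n::{finite,linorder}) vec \<Rightarrow> real) \<Rightarrow> (real, 'n) vec \<Rightarrow> (real, 'n) vec \<Rightarrow> real" where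
  "taylor_remainder r f x u =
     f u - f x -
     (\<Sum>\<nu> = 1..r. \<Sum>h | (\<Sum>i\<in>UNIV. h i) = \<nu>.
        D_multi h f x / (\<Prod>i\<in>UNIV. fact (h i)) * (\<Prod>i\<in>UNIV. (u $ i - x $ i) ^ h i))"

lemma finite_multi_indices: "finite {h :: 'n::finite \<Rightarrow> nat. (\<Sum>i\<in>UNIV. h i) = \<nu>}"
proof (rule finite_subset)
  show "{h :: 'n \<Rightarrow> nat. (\<Sum>i\<in>UNIV. h i) = \<nu>} \<subseteq> PiE UNIV (\<lambda>_. {..\<nu>})"
    by (auto simp: PiE_def intro: member_le_sum)
qed (auto intro: finite_PiE)

lemma C_space_0: "C_space 0 = C0"
  by (auto simp: C_space_def C0_def iter_partial_def uniformly_continuous_imp_continuous)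

end

theory Submission
  imports Defs "HOL-Combinatorics.Multiset_Permutations"
begin

text \<open>
  Write \<open>d\<^sub>i = \<bar>u\<^sub>i - x\<^sub>i\<bar>\<close>. Evaluating at \<open>u\<close> the Taylor polynomial of order \<open>r - 1\<close> centred at
  a point moving along a curve \<open>z\<close> from \<open>u\<close> to \<open>x\<close>, and integrating the derivative, expresses the
  remainder as a sum over index tuples of averages of \<open>F (z y) - F x\<close>, where \<open>F\<close> runs over the
  derivatives of order \<open>r\<close>. The straight segment does not give the bound, since coordinates with small
  \<open>d\<^sub>i\<close> would be charged for displacements in the large ones. On the curve
  \<open>z\<^sub>i(y) = u\<^sub>i - (u\<^sub>i - x\<^sub>i) y\<^bsup>\<mu>\<^esup>\<close> with \<open>\<mu>\<close> proportional to \<open>d\<^sub>i\<close> to the power \<open>- (r + 1) / r\<close>, the small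
  coordinates leave \<open>x\<close> first, and by the AM-GM inequality the mean displacement weighted for the
  tuple \<open>i\<^sub>1, \<dots>, i\<^sub>r\<close> is at most \<open>N \<Gamma> / (r + 1)\<close>, where \<open>\<Gamma>\<close> is the geometric mean of the \<open>d\<close> of the tuple.

  Jensen's inequality then bounds the average by \<open>2 K (c \<Gamma>)\<close> with \<open>c = N / (2 (r + 1))\<close>, but \<open>\<Gamma>\<^sup>r K (c \<Gamma>)\<close>
  is in general not below the mean of the \<open>d\<^sup>r K (c d)\<close>. Splitting the curve at the median of its
  weight improves the bound to \<open>K (5 c \<Gamma> / 7) + K (9 c \<Gamma> / 7)\<close>, and this suffices: a concave function
  dominates a combination of \<open>min t (5 / 7)\<close> and \<open>min t (9 / 7)\<close> with the same values at the two
  kinks, for which the required inequality is linear in \<open>ln t\<close>.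
\<close>

subsection \<open>Symmetry of iterated partial derivatives\<close>

lemma partial_deriv_frechet:
  assumes "(f has_derivative f') (at x)"
  shows "partial_deriv i f x = f' (axis i 1)"
proof -
  interpret f': bounded_linear f' using assms by (rule has_derivative_bounded_linear)
  have "((\<lambda>t. f (x + t *\<^sub>R axis i 1)) has_derivative (\<lambda>t. f' (t *\<^sub>R axis i 1))) (at 0)"
  proof (rule has_derivative_compose[where g = f])
    show "((\<lambda>t. x + t *\<^sub>R axis i 1) has_derivative (\<lambda>t. t *\<^sub>R axis i 1)) (at 0)"
      by (auto intro!: derivative_eq_intros)
  qed (use assms in simp)
  then have "((\<lambda>t. f (x + t *\<^sub>R axis i 1)) has_real_derivative f' (axis i 1)) (at 0)"
    by (simp add: has_field_derivative_def f'.scaleR mult_commute_abs)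
  then show ?thesis
    unfolding partial_deriv_def by (rule DERIV_imp_deriv)
qed

lemma has_derivative_partial_deriv:
  fixes f :: "real ^ 'n::finite \<Rightarrow> real"
  assumes "f differentiable (at x)"
  shows "(f has_derivative (\<lambda>v. \<Sum>i\<in>UNIV. v $ i * partial_deriv i f x)) (at x)"
proof -
  obtain f' where f': "(f has_derivative f') (at x)"
    using assms unfolding differentiable_def by blast
  interpret f': bounded_linear f' using f' by (rule has_derivative_bounded_linear)
  have "f' v = (\<Sum>i\<in>UNIV. v $ i * partial_deriv i f x)" for v
  proof -
    have "f' v = f' (\<Sum>i\<in>UNIV. v $ i *\<^sub>R axis i 1)"
      using basis_expansion[of v] by (simp add: scalar_mult_eq_scaleR)
    then show ?thesis
      by (simp add: f'.sum f'.scaleR partial_deriv_frechet[OF f'])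
  qed
  then have "f' = (\<lambda>v. \<Sum>i\<in>UNIV. v $ i * partial_deriv i f x)" by blast
  with f' show ?thesis by metis
qed

lemma has_real_derivative_along_curve:
  fixes f :: "real ^ 'n::finite \<Rightarrow> real"
  assumes f: "f differentiable (at (z t))"
    and z: "\<And>i. ((\<lambda>t. z t $ i) has_real_derivative z' i) (at t)"
  shows "((\<lambda>t. f (z t)) has_real_derivative (\<Sum>i\<in>UNIV. z' i * partial_deriv i f (z t))) (at t)"
proof -
  have z_eq: "w = (\<Sum>i\<in>UNIV. w $ i *\<^sub>R axis i 1)" for w :: "real ^ 'n"
    using basis_expansion[of w] by (simp add: scalar_mult_eq_scaleR)
  have "((\<lambda>t. \<Sum>i\<in>UNIV. z t $ i *\<^sub>R axis i (1::real)) has_derivative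
      (\<lambda>h. \<Sum>i\<in>UNIV. (z' i * h) *\<^sub>R axis i (1::real))) (at t)"
    using z by (intro has_derivative_sum has_derivative_scaleR_left) (auto simp: has_field_derivative_def)
  then have "(z has_derivative (\<lambda>h. \<chi> i. z' i * h)) (at t)"
    using z_eq[of "z _"] z_eq[of "\<chi> i. z' i * _"] by simp
  from has_derivative_compose[OF this has_derivative_partial_deriv[OF f]]
  moreover have "(\<lambda>h. \<Sum>i\<in>UNIV. (\<chi> i. z' i * h) $ i * partial_deriv i f (z t))
      = (*) (\<Sum>i\<in>UNIV. z' i * partial_deriv i f (z t))"
    by (simp add: fun_eq_iff sum_distrib_left mult_ac)
  ultimately show ?thesis
    by (simp add: has_field_derivative_def)
qed

lemma has_real_derivative_along_axis:
  fixes f :: "real ^ 'n::finite \<Rightarrow> real"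
  assumes "\<And>x. f differentiable (at x)"
  shows "((\<lambda>t. f (p + t *\<^sub>R axis i 1)) has_real_derivative partial_deriv i f (p + t *\<^sub>R axis i 1)) (at t)"
proof -
  have "((\<lambda>t. f (p + t *\<^sub>R axis i 1)) has_real_derivative
      (\<Sum>j\<in>UNIV. (axis i 1 $ j) * partial_deriv j f (p + t *\<^sub>R axis i 1))) (at t)"
    by (rule has_real_derivative_along_curve) (auto intro!: derivative_eq_intros assms)
  then show ?thesis
    by (simp add: axis_def if_distrib[of "\<lambda>a. a * _"] cong: if_cong)
qed

text \<open>The mean value theorem is used twice: along axis \<open>i\<close> for the increment of
  \<open>f\<close> in direction \<open>j\<close>, then along axis \<open>j\<close> for
  \<open>partial_deriv i f\<close>. The second difference is symmetric in \<open>i\<close> and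
  \<open>j\<close>, whereas the derivative that represents it is not.\<close>

lemma mixed_difference_eq:
  fixes f :: "real ^ 'n::finite \<Rightarrow> real"
  assumes f: "\<And>x. f differentiable (at x)" and fi: "\<And>x. partial_deriv i f differentiable (at x)"
    and "h > 0"
  obtains s t where "0 \<le> s" "s \<le> h" "0 \<le> t" "t \<le> h"
    "f (x + h *\<^sub>R axis i 1 + h *\<^sub>R axis j 1) - f (x + h *\<^sub>R axis i 1) - f (x + h *\<^sub>R axis j 1) + f x
      = h * h * partial_deriv j (partial_deriv i f) (x + s *\<^sub>R axis i 1 + t *\<^sub>R axis j 1)"
proof -
  let ?\<phi> = "\<lambda>s. f ((x + h *\<^sub>R axis j 1) + s *\<^sub>R axis i 1) - f (x + s *\<^sub>R axis i 1)"
  have "(?\<phi> has_real_derivative (partial_deriv i f ((x + h *\<^sub>R axis j 1) + s *\<^sub>R axis i 1)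
      - partial_deriv i f (x + s *\<^sub>R axis i 1))) (at s)" for s
    by (intro DERIV_diff has_real_derivative_along_axis f)
  from MVT2[OF \<open>h > 0\<close> this] obtain s where s: "0 < s" "s < h"
    "?\<phi> h - ?\<phi> 0 = h * (partial_deriv i f ((x + h *\<^sub>R axis j 1) + s *\<^sub>R axis i 1)
      - partial_deriv i f (x + s *\<^sub>R axis i 1))"
    by auto
  from MVT2[OF \<open>h > 0\<close> has_real_derivative_along_axis[OF fi]]
  obtain t where t: "0 < t" "t < h"
    "partial_deriv i f ((x + s *\<^sub>R axis i 1) + h *\<^sub>R axis j 1) - partial_deriv i f ((x + s *\<^sub>R axis i 1) + 0 *\<^sub>R axis j 1)
     = (h - 0) * partial_deriv j (partial_deriv i f) (x + s *\<^sub>R axis i 1 + t *\<^sub>R axis j 1)"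
    by metis
  show ?thesis
    by (rule that[of s t]) (use s t in \<open>auto simp: algebra_simps\<close>)
qed

lemma times_cont_diff_SucD: "times_cont_diff (Suc k) f \<Longrightarrow> times_cont_diff k f"
proof (induction k arbitrary: f)
  case 0
  then show ?case
    by (auto intro!: differentiable_imp_continuous_on simp: differentiable_on_def
        intro: differentiable_at_withinI)
qed simp

lemma times_cont_diff_imp_continuous: "times_cont_diff k f \<Longrightarrow> continuous_on UNIV f"
proof (induction k)
  case (Suc k)
  then show ?case using times_cont_diff_SucD by blast
qed simp

text \<open>Both mixed derivatives, taken at points that approach \<open>x\<close>, equal the same
  second difference divided by the squared step. Continuity of the second-order derivatives carries
  this to the limit.\<close>

lemma partial_deriv_commute:
  fixes f :: "real ^ 'n::finite \<Rightarrow> real"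
  assumes f: "times_cont_diff (Suc (Suc k)) f"
  shows "partial_deriv i (partial_deriv j f) = partial_deriv j (partial_deriv i f)"
proof
  fix x
  have d: "\<And>x. f differentiable (at x)" "\<And>i x. partial_deriv i f differentiable (at x)"
    and k: "\<And>i j. times_cont_diff k (partial_deriv i (partial_deriv j f))"
    using f by simp_all
  have c: "isCont (partial_deriv i (partial_deriv j f)) x" for i j
    using times_cont_diff_imp_continuous[OF k] by (simp add: continuous_on_eq_continuous_at)
  define a where "a = (\<lambda>n. inverse (real (Suc n)))"
  have a0: "a n > 0" for n by (simp add: a_def)
  have a: "a \<longlonglongrightarrow> 0" unfolding a_def by (rule LIMSEQ_inverse_real_of_nat)
  let ?\<Delta> = "\<lambda>n. f (x + a n *\<^sub>R axis i 1 + a n *\<^sub>R axis j 1) - f (x + a n *\<^sub>R axis i 1) - f (x + a n *\<^sub>R axis j 1) + f x"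
  have "\<exists>s t. 0 \<le> s \<and> s \<le> a n \<and> 0 \<le> t \<and> t \<le> a n \<and>
      ?\<Delta> n = a n * a n * partial_deriv j (partial_deriv i f) (x + s *\<^sub>R axis i 1 + t *\<^sub>R axis j 1)" for n
    by (rule mixed_difference_eq[OF d(1) d(2) a0, where x = x]) blast
  then obtain s t where st: "\<And>n. 0 \<le> s n" "\<And>n. s n \<le> a n" "\<And>n. 0 \<le> t n" "\<And>n. t n \<le> a n"
      "\<And>n. ?\<Delta> n = a n * a n * partial_deriv j (partial_deriv i f) (x + s n *\<^sub>R axis i 1 + t n *\<^sub>R axis j 1)"
    by metis
  have "\<exists>s t. 0 \<le> s \<and> s \<le> a n \<and> 0 \<le> t \<and> t \<le> a n \<and>
      ?\<Delta> n = a n * a n * partial_deriv i (partial_deriv j f) (x + s *\<^sub>R axis j 1 + t *\<^sub>R axis i 1)" for n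
  proof -
    obtain s t where st: "0 \<le> s" "s \<le> a n" "0 \<le> t" "t \<le> a n"
      "f (x + a n *\<^sub>R axis j 1 + a n *\<^sub>R axis i 1) - f (x + a n *\<^sub>R axis j 1) - f (x + a n *\<^sub>R axis i 1) + f x
        = a n * a n * partial_deriv i (partial_deriv j f) (x + s *\<^sub>R axis j 1 + t *\<^sub>R axis i 1)"
      by (rule mixed_difference_eq[where f = f and i = j and j = i and x = x, OF d(1) d(2) a0])
    have swap: "x + a n *\<^sub>R axis j 1 + a n *\<^sub>R axis i 1 = x + a n *\<^sub>R axis i 1 + a n *\<^sub>R axis j 1"
      by (simp only: add.assoc add.commute[of "a n *\<^sub>R axis j 1"])
    from st(5)[unfolded swap] have "?\<Delta> n = a n * a n * partial_deriv i (partial_deriv j f) (x + s *\<^sub>R axis j 1 + t *\<^sub>R axis i 1)"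
      by linarith
    with st(1-4) show ?thesis by blast
  qed
  then obtain s' t' where st': "\<And>n. 0 \<le> s' n" "\<And>n. s' n \<le> a n" "\<And>n. 0 \<le> t' n" "\<And>n. t' n \<le> a n"
      "\<And>n. ?\<Delta> n = a n * a n * partial_deriv i (partial_deriv j f) (x + s' n *\<^sub>R axis j 1 + t' n *\<^sub>R axis i 1)"
    by metis
  have lim0: "b \<longlonglongrightarrow> 0" if "\<And>n. 0 \<le> b n" "\<And>n. b n \<le> a n" for b
    by (rule tendsto_sandwich[OF _ _ tendsto_const a]) (use that in auto)
  have lim: "(\<lambda>n. F (x + b n *\<^sub>R axis k 1 + b' n *\<^sub>R axis l 1)) \<longlonglongrightarrow> F x"
    if "isCont F x" "b \<longlonglongrightarrow> 0" "b' \<longlonglongrightarrow> 0" for F :: "real ^ 'n \<Rightarrow> real" and b b' k l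
  proof (rule isCont_tendsto_compose[OF that(1)])
    show "(\<lambda>n. x + b n *\<^sub>R axis k 1 + b' n *\<^sub>R axis l 1) \<longlonglongrightarrow> x"
      using tendsto_add[OF tendsto_add[OF tendsto_const[of x] tendsto_scaleR[OF that(2) tendsto_const[of "axis k 1"]]]
          tendsto_scaleR[OF that(3) tendsto_const[of "axis l 1"]]]
      by simp
  qed
  have "partial_deriv j (partial_deriv i f) (x + s n *\<^sub>R axis i 1 + t n *\<^sub>R axis j 1)
      = partial_deriv i (partial_deriv j f) (x + s' n *\<^sub>R axis j 1 + t' n *\<^sub>R axis i 1)" for n
    using st(5)[of n] st'(5)[of n] a0[of n] by simp
  then have "(\<lambda>n. partial_deriv i (partial_deriv j f) (x + s' n *\<^sub>R axis j 1 + t' n *\<^sub>R axis i 1))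
      \<longlonglongrightarrow> partial_deriv j (partial_deriv i f) x"
    using lim[OF c lim0 lim0, of s t j i i j] st by simp
  moreover have "(\<lambda>n. partial_deriv i (partial_deriv j f) (x + s' n *\<^sub>R axis j 1 + t' n *\<^sub>R axis i 1))
      \<longlonglongrightarrow> partial_deriv i (partial_deriv j f) x"
    using lim[OF c lim0 lim0] st' by blast
  ultimately show "partial_deriv i (partial_deriv j f) x = partial_deriv j (partial_deriv i f) x"
    using LIMSEQ_unique by blast
qed

lemma iter_partial_simps [simp]:
  "iter_partial [] f = f"
  "iter_partial (i # is) f = partial_deriv i (iter_partial is f)"
  "iter_partial (is @ js) f = iter_partial is (iter_partial js f)"
  by (simp_all add: iter_partial_def)

lemma times_cont_diff_iter_partial:
  assumes "times_cont_diff (length is + k) f"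
  shows "times_cont_diff k (iter_partial is f)"
  using assms
proof (induction "is" arbitrary: k)
  case (Cons i "is")
  from Cons.IH[of "Suc k"] Cons.prems show ?case by simp
qed simp

lemma iter_partial_move:
  assumes "times_cont_diff (Suc (length is)) f"
  shows "iter_partial is (partial_deriv i f) = partial_deriv i (iter_partial is f)"
  using assms
proof (induction "is")
  case (Cons j "is")
  have "times_cont_diff (Suc (Suc 0)) (iter_partial is f)"
    using Cons.prems times_cont_diff_iter_partial[of "is" 2 f] by (simp add: numeral_2_eq_2)
  moreover have "times_cont_diff (Suc (length is)) f"
    using times_cont_diff_SucD[OF Cons.prems] by simp
  ultimately have "iter_partial is (partial_deriv i f) = partial_deriv i (iter_partial is f)"
    and "partial_deriv j (partial_deriv i (iter_partial is f)) = partial_deriv i (partial_deriv j (iter_partial is f))"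
    by (auto simp only: length_Cons intro: Cons.IH partial_deriv_commute)
  then show ?case by simp
qed simp


text \<open>By induction on \<open>is\<close>: the head of \<open>is\<close> occurs somewhere in
  \<open>js\<close>, and \<open>iter_partial_move\<close> brings it to the front there, leaving
  tails with equal multisets.\<close>

lemma iter_partial_mset_cong:
  assumes "mset is = mset js" "times_cont_diff (length is) f"
  shows "iter_partial is f = iter_partial js f"
  using assms
proof (induction "is" arbitrary: js)
  case (Cons i "is")
  then have "i \<in> set js" by (metis list.set_intros(1) set_mset_mset)
  then obtain as bs where js: "js = as @ i # bs" by (auto simp: in_set_conv_decomp)
  then have ms: "mset is = mset (as @ bs)" using Cons.prems(1) by simp
  then have "length is = length as + length bs" using mset_eq_length by fastforce
  then have "times_cont_diff (length bs + Suc (length as)) f"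
    using Cons.prems(2) by (simp add: add.commute)
  then have "times_cont_diff (Suc (length as)) (iter_partial bs f)"
    by (rule times_cont_diff_iter_partial)
  then have "iter_partial js f = partial_deriv i (iter_partial (as @ bs) f)"
    using js iter_partial_move by simp
  moreover have "times_cont_diff (length is) f"
    using times_cont_diff_SucD Cons.prems(2) by simp
  ultimately show ?case using Cons.IH[OF ms] by simp
qed simp

subsection \<open>Multi-indices and index tuples\<close>

lemma finite_lists_of_length: "finite {is :: 'a::finite list. length is = n}"
  using finite_lists_length_eq[of "UNIV :: 'a set" n] by simp

text \<open>The blocks follow the order of differentiation in \<open>D_multi\<close>, so the two
  agree as compositions of operators.\<close>

definition list_of_multi_index :: "('n::{finite,linorder} \<Rightarrow> nat) \<Rightarrow> 'n list" where
  "list_of_multi_index h = concat (map (\<lambda>i. replicate (h i) i) (sorted_list_of_set UNIV))"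

lemma count_list_of_multi_index [simp]: "count (mset (list_of_multi_index h)) = h"
proof
  fix j
  have "count (mset (concat (map (\<lambda>i. replicate (h i) i) ks))) j = (if j \<in> set ks then h j else 0)"
    if "distinct ks" for ks
    using that by (induction ks) auto
  from this[of "sorted_list_of_set UNIV"] show "count (mset (list_of_multi_index h)) j = h j"
    by (simp add: list_of_multi_index_def)
qed

lemma D_multi_eq_iter_partial: "D_multi h f = iter_partial (list_of_multi_index h) f"
proof -
  have "foldr (\<lambda>i. partial_deriv i ^^ h i) ks f = iter_partial (concat (map (\<lambda>i. replicate (h i) i) ks)) f" for ks
  proof (induction ks)
    case (Cons k ks)
    have "(partial_deriv k ^^ n) g = iter_partial (replicate n k) g" for n g
      by (induction n) auto
    with Cons show ?case by simp
  qed simp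
  then show ?thesis by (simp add: D_multi_def list_of_multi_index_def)
qed

lemma prod_list_map_eq_prod_count:
  "(\<Prod>i\<leftarrow>is. \<delta> i) = (\<Prod>i\<in>UNIV. \<delta> i ^ count (mset is) i)" for \<delta> :: "'a::finite \<Rightarrow> real"
proof -
  have "(\<Prod>i\<leftarrow>is. \<delta> i) = prod_mset (image_mset \<delta> (mset is))"
    by (metis mset_map prod_mset_prod_list)
  also have "\<dots> = (\<Prod>i\<in>set_mset (mset is). \<delta> i ^ count (mset is) i)"
    by (rule image_prod_mset_multiplicity)
  also have "\<dots> = (\<Prod>i\<in>UNIV. \<delta> i ^ count (mset is) i)"
  proof (rule prod.mono_neutral_left)
    show "\<forall>i\<in>UNIV - set_mset (mset is). \<delta> i ^ count (mset is) i = 1"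
    proof
      fix i assume "i \<in> UNIV - set_mset (mset is)"
      then have "i \<notin># mset is" by blast
      then have "count (mset is) i = 0" unfolding not_in_iff .
      then show "\<delta> i ^ count (mset is) i = 1" by (simp only: power_0)
    qed
  qed auto
  finally show ?thesis .
qed

lemma size_eq_sum_count: "size M = (\<Sum>i\<in>UNIV. count M i)" for M :: "'a::finite multiset"
  unfolding size_multiset_overloaded_eq
  by (rule sum.mono_neutral_left) (auto simp: not_in_iff)

text \<open>The lists are the arrangements of \<open>M\<close>, so their number is a multinomial
  coefficient.\<close>

lemma card_lists_with_count:
  fixes h :: "'a::finite \<Rightarrow> nat"
  assumes "count M = h"
  shows "real (card {is. mset is = M}) * (\<Prod>i\<in>UNIV. fact (h i)) = fact (\<Sum>i\<in>UNIV. h i)"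
proof -
  have "real (card (permutations_of_multiset M) * (\<Prod>i\<in>set_mset M. fact (count M i))) = real (fact (size M))"
    by (simp only: card_permutations_of_multiset_aux)
  moreover have "(\<Prod>i\<in>set_mset M. fact (count M i) :: real) = (\<Prod>i\<in>UNIV. fact (count M i))"
    by (rule prod.mono_neutral_left) (auto simp: not_in_iff)
  ultimately show ?thesis
    by (simp add: permutations_of_multiset_def assms[symmetric] size_eq_sum_count)
qed

text \<open>Tuples are grouped by their count function \<open>h\<close>. A class has n! / h!
  members, and its summands coincide because the derivatives commute.\<close>

lemma sum_multi_indices_eq_sum_lists:
  fixes f :: "real ^ 'n::{finite,linorder} \<Rightarrow> real" and \<delta> :: "'n \<Rightarrow> real"
  assumes "times_cont_diff n f"
  shows "(\<Sum>h | (\<Sum>i\<in>UNIV. h i) = n. D_multi h f x / (\<Prod>i\<in>UNIV. fact (h i)) * (\<Prod>i\<in>UNIV. \<delta> i ^ h i))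
    = (\<Sum>is | length is = n. (\<Prod>i\<leftarrow>is. \<delta> i) * iter_partial is f x) / fact n"
proof -
  let ?T = "{h. (\<Sum>i\<in>UNIV. h i) = n}" and ?S = "{is :: 'n list. length is = n}"
  have grouped: "(\<Sum>is\<in>?S. (\<Prod>i\<leftarrow>is. \<delta> i) * iter_partial is f x)
      = (\<Sum>h\<in>?T. \<Sum>is | is \<in> ?S \<and> count (mset is) = h. (\<Prod>i\<leftarrow>is. \<delta> i) * iter_partial is f x)"
    by (rule sum.group[symmetric])
       (auto simp: finite_lists_of_length finite_multi_indices size_eq_sum_count[symmetric])
  have classes: "(\<Sum>h\<in>?T. \<Sum>is | is \<in> ?S \<and> count (mset is) = h. (\<Prod>i\<leftarrow>is. \<delta> i) * iter_partial is f x)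
      = (\<Sum>h\<in>?T. fact n * (D_multi h f x / (\<Prod>i\<in>UNIV. fact (h i)) * (\<Prod>i\<in>UNIV. \<delta> i ^ h i)))"
  proof (rule sum.cong[OF refl])
    fix h :: "'n \<Rightarrow> nat" assume h: "h \<in> ?T"
    let ?M = "mset (list_of_multi_index h)"
    have M: "(count (mset is) = h) = (mset is = ?M)" for "is"
      by (simp add: multiset_eq_iff fun_eq_iff)
    have len: "length is = n" if "mset is = ?M" for "is"
    proof -
      have "size (mset is) = n"
        unfolding that size_eq_sum_count using h by simp
      then show ?thesis by simp
    qed
    have "(\<Prod>i\<leftarrow>is. \<delta> i) * iter_partial is f x = (\<Prod>i\<in>UNIV. \<delta> i ^ h i) * D_multi h f x"
      if "mset is = ?M" for "is"
    proof -
      have "iter_partial is f = D_multi h f"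
        unfolding D_multi_eq_iter_partial
        by (rule iter_partial_mset_cong[OF that]) (simp only: len[OF that] assms)
      moreover have "(\<Prod>i\<leftarrow>is. \<delta> i) = (\<Prod>i\<in>UNIV. \<delta> i ^ h i)"
        unfolding prod_list_map_eq_prod_count that by simp
      ultimately show ?thesis by simp
    qed
    moreover have "{is. is \<in> ?S \<and> count (mset is) = h} = {is. mset is = ?M}"
      using M len by blast
    ultimately have "(\<Sum>is | is \<in> ?S \<and> count (mset is) = h. (\<Prod>i\<leftarrow>is. \<delta> i) * iter_partial is f x)
        = real (card {is. mset is = ?M}) * ((\<Prod>i\<in>UNIV. \<delta> i ^ h i) * D_multi h f x)"
      by simp
    moreover have "real (card {is. mset is = ?M}) * (\<Prod>i\<in>UNIV. fact (h i)) = fact n"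
      using card_lists_with_count[of ?M h] h by simp
    then have "real (card {is. mset is = ?M}) = fact n / (\<Prod>i\<in>UNIV. fact (h i))"
      by (simp add: field_simps)
    ultimately show "(\<Sum>is | is \<in> ?S \<and> count (mset is) = h. (\<Prod>i\<leftarrow>is. \<delta> i) * iter_partial is f x)
        = fact n * (D_multi h f x / (\<Prod>i\<in>UNIV. fact (h i)) * (\<Prod>i\<in>UNIV. \<delta> i ^ h i))"
      by simp
  qed
  have factor: "(\<Sum>h\<in>?T. fact n * (D_multi h f x / (\<Prod>i\<in>UNIV. fact (h i)) * (\<Prod>i\<in>UNIV. \<delta> i ^ h i)))
      = fact n * (\<Sum>h\<in>?T. D_multi h f x / (\<Prod>i\<in>UNIV. fact (h i)) * (\<Prod>i\<in>UNIV. \<delta> i ^ h i))"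
    by (rule sum_distrib_left[symmetric])
  show ?thesis
    unfolding grouped classes factor by simp
qed

section \<open>Taylor polynomials as sums over index tuples\<close>

lemma times_cont_diff_le: "times_cont_diff k f" if "times_cont_diff n f" "k \<le> n"
  using that(2,1) by (induction rule: inc_induct) (auto dest: times_cont_diff_SucD simp del: times_cont_diff.simps)

text \<open>The bound on the order is strict: for \<open>n = r\<close> this is the Taylor polynomial
  of order r - 1, whose coefficients can still be differentiated once in the centre when
  \<open>f\<close> is \<open>r\<close> times differentiable.\<close>

definition taylor_list :: "nat \<Rightarrow> (real ^ 'n::finite \<Rightarrow> real) \<Rightarrow> real ^ 'n \<Rightarrow> real ^ 'n \<Rightarrow> real" where
  "taylor_list n f x u = (\<Sum>\<nu><n. (\<Sum>is | length is = \<nu>. (\<Prod>i\<leftarrow>is. u $ i - x $ i) * iter_partial is f x) / fact \<nu>)"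

lemma taylor_remainder_eq:
  fixes f :: "real ^ 'n::{finite,linorder} \<Rightarrow> real"
  assumes "times_cont_diff r f"
  shows "taylor_remainder r f x u = f u - taylor_list r f x u
    - (\<Sum>is | length is = r. (\<Prod>i\<leftarrow>is. u $ i - x $ i) * iter_partial is f x) / fact r"
proof -
  let ?t = "\<lambda>\<nu>. (\<Sum>is | length is = \<nu>. (\<Prod>i\<leftarrow>is. u $ i - x $ i) * iter_partial is f x) / fact \<nu>"
  have "taylor_remainder r f x u = f u - f x - (\<Sum>\<nu>=1..r. ?t \<nu>)"
    unfolding taylor_remainder_def
    by (intro arg_cong2[where f = minus] refl sum.cong sum_multi_indices_eq_sum_lists
        times_cont_diff_le[OF assms]) auto
  \<comment> \<open>Order 0 contributes only the empty tuple, whose term is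
    \<open>f x\<close>.\<close>
  moreover have "{..r} = insert 0 {1..r}" by auto
  then have "f x + (\<Sum>\<nu>=1..r. ?t \<nu>) = (\<Sum>\<nu>\<le>r. ?t \<nu>)"
    by simp
  then have "f x + (\<Sum>\<nu>=1..r. ?t \<nu>) = taylor_list r f x u + ?t r"
    by (simp add: taylor_list_def flip: lessThan_Suc_atMost)
  ultimately show ?thesis by linarith
qed

subsection \<open>Integral form of the remainder\<close>

lemma mset_rotate: "mset (rotate n xs) = mset xs"
  unfolding rotate_drop_take by (metis append_take_drop_id mset_append union_commute)

text \<open>Rotation by \<open>j\<close> permutes the tuples, brings entry \<open>j\<close> to the
  front and preserves the multiset, so all positions have the same total.\<close>

lemma sum_lists_nth_eq_first:
  fixes W :: "'a::finite \<Rightarrow> 'a list \<Rightarrow> real"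
  assumes "\<And>is js a. mset is = mset js \<Longrightarrow> length is = n \<Longrightarrow> W a is = W a js"
  shows "(\<Sum>is | length is = n. \<Sum>j<n. W (is ! j) is) = real n * (\<Sum>is | length is = n. W (is ! 0) is)"
proof -
  have "(\<Sum>is | length is = n. W (is ! j) is) = (\<Sum>is | length is = n. W (is ! 0) is)" if "j < n" for j
  proof -
    have "(\<Sum>is | length is = n. W (is ! 0) is) = (\<Sum>is | length is = n. W (rotate j is ! 0) (rotate j is))"
      by (rule sum.reindex_bij_witness[of _ "rotate j" "rotate (n - j)"])
         (use that in \<open>auto simp: rotate_rotate rotate_id\<close>)
    also have "\<dots> = (\<Sum>is | length is = n. W (is ! j) is)"
    proof (rule sum.cong[OF refl])
      fix "is" :: "'a list" assume "is \<in> {is. length is = n}"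
      then have l: "length is = n" by simp
      have "rotate j is ! 0 = is ! j" using l \<open>j < n\<close> by (subst nth_rotate) auto
      moreover have "W (is ! j) is = W (is ! j) (rotate j is)" by (rule assms) (simp_all add: l mset_rotate)
      ultimately show "W (rotate j is ! 0) (rotate j is) = W (is ! j) is" by simp
    qed
    finally show ?thesis by simp
  qed
  then have "(\<Sum>j<n. \<Sum>is | length is = n. W (is ! j) is) = (\<Sum>j<n. \<Sum>is | length is = n. W (is ! 0) is)"
    by (rule sum.cong[OF refl]) (simp only: lessThan_iff)
  then show ?thesis
    unfolding sum.swap[of _ "{..<n}"] by simp
qed

lemma sum_lists_Suc:
  "(\<Sum>is | length is = Suc n. g is) = (\<Sum>is | length is = n. \<Sum>i\<in>UNIV. g (i # is))"
  for g :: "'a::finite list \<Rightarrow> real"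
proof -
  have "(\<Sum>is | length is = n. \<Sum>i\<in>UNIV. g (i # is)) = (\<Sum>(is, i)\<in>{is. length is = n} \<times> UNIV. g (i # is))"
    by (rule sum.cartesian_product)
  also have "\<dots> = (\<Sum>is | length is = Suc n. g is)"
    by (rule sum.reindex_bij_witness[of _ "\<lambda>is. (tl is, hd is)" "\<lambda>(is, i). i # is"]) (auto simp: length_Suc_conv)
  finally show ?thesis ..
qed

section \<open>Power curves and the Taylor polynomial along them\<close>

definition power_curve :: "('n::finite \<Rightarrow> real) \<Rightarrow> real ^ 'n \<Rightarrow> real ^ 'n \<Rightarrow> real \<Rightarrow> real ^ 'n" where
  "power_curve \<mu> x u y = (\<chi> i. u $ i - (u $ i - x $ i) * y powr \<mu> i)"

lemma power_curve_nth [simp]: "power_curve \<mu> x u y $ i = u $ i - (u $ i - x $ i) * y powr \<mu> i"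
  by (simp add: power_curve_def)

lemma power_curve_0 [simp]: "power_curve \<mu> x u 0 = u"
  and power_curve_1 [simp]: "power_curve \<mu> x u 1 = x"
  by (simp_all add: vec_eq_iff)

lemma continuous_on_powr_const:
  "0 < a \<Longrightarrow> continuous_on {0..b} (\<lambda>y. y powr a)" for a b :: real
  by (intro continuous_on_powr' continuous_intros) auto

lemma continuous_on_power_curve:
  assumes "\<And>i. \<mu> i > 0"
  shows "continuous_on {0..1} (power_curve \<mu> x u)"
  unfolding power_curve_def
  by (intro continuous_intros continuous_on_powr_const assms)

lemma continuous_on_compose_power_curve:
  assumes "\<And>i. \<mu> i > 0" "continuous_on UNIV F"
  shows "continuous_on {0..1} (\<lambda>y. F (power_curve \<mu> x u y))"
  using continuous_on_compose2[OF assms(2) continuous_on_power_curve[of \<mu>, OF assms(1)]] by simp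

lemma prod_list_powr_eq:
  "y > 0 \<Longrightarrow> (\<Prod>i\<leftarrow>is. d i * y powr l i) = (\<Prod>i\<leftarrow>is. d i) * y powr (\<Sum>i\<leftarrow>is. l i)" for y :: real
  by (induction "is") (auto simp: powr_add)

lemma has_real_derivative_prod_list_powr:
  assumes "y > 0"
  shows "((\<lambda>y. \<Prod>i\<leftarrow>is. d i * y powr l i) has_real_derivative
      (\<Prod>i\<leftarrow>is. d i) * (\<Sum>i\<leftarrow>is. l i) * y powr ((\<Sum>i\<leftarrow>is. l i) - 1)) (at y)"
proof (rule has_field_derivative_transform_within_open)
  show "((\<lambda>y. (\<Prod>i\<leftarrow>is. d i) * y powr (\<Sum>i\<leftarrow>is. l i)) has_real_derivative
      (\<Prod>i\<leftarrow>is. d i) * (\<Sum>i\<leftarrow>is. l i) * y powr ((\<Sum>i\<leftarrow>is. l i) - 1)) (at y)"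
    using assms by (auto intro!: derivative_eq_intros)
  show "(\<Prod>i\<leftarrow>is. d i) * y powr (\<Sum>i\<leftarrow>is. l i) = (\<Prod>i\<leftarrow>is. d i * y powr l i)" if "y \<in> {0<..}" for y
    using that prod_list_powr_eq[of y d l "is"] by simp
qed (use assms in auto)

lemma taylor_list_at_self: "r \<ge> 1 \<Longrightarrow> taylor_list r f u u = f u"
proof -
  assume "r \<ge> 1"
  have "(\<Sum>is | length is = \<nu>. (\<Prod>i\<leftarrow>is. u $ i - u $ i) * iter_partial is f u) = (if \<nu> = 0 then f u else 0)" for \<nu>
  proof (cases \<nu>)
    case (Suc n)
    have "(\<Prod>i\<leftarrow>is. u $ i - u $ i) = 0" if "length is = \<nu>" for "is" :: "'a list"
      using that Suc by (cases "is") auto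
    then show ?thesis using Suc by simp
  qed simp
  then show ?thesis
    using \<open>r \<ge> 1\<close> unfolding taylor_list_def by (simp add: if_distrib[of "\<lambda>a. a / _"] cong: if_cong)
qed

text \<open>By symmetry of the derivatives, the exponent of the first index of a tuple may be averaged over all
  positions; this makes the derivative telescope.\<close>

lemma has_real_derivative_taylor_list_power_curve:
  fixes f :: "real ^ 'n::finite \<Rightarrow> real" and x u :: "real ^ 'n" and \<mu> :: "'n \<Rightarrow> real"
  assumes f: "times_cont_diff r f" and y: "y > 0"
  defines "A \<equiv> \<lambda>\<nu>. (\<Sum>is | length is = \<nu>. (\<Prod>i\<leftarrow>is. u $ i - x $ i) * (\<Sum>i\<leftarrow>is. \<mu> i)
      * y powr ((\<Sum>i\<leftarrow>is. \<mu> i) - 1) * iter_partial is f (power_curve \<mu> x u y)) / fact \<nu>"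
  shows "((\<lambda>y. taylor_list r f (power_curve \<mu> x u y) u) has_real_derivative - A r) (at y)"
proof -
  let ?z = "power_curve \<mu> x u"
  let ?P = "\<lambda>is. \<Prod>i\<leftarrow>is. u $ i - x $ i" and ?L = "\<lambda>is. \<Sum>i\<leftarrow>is. \<mu> i"
  let ?z' = "\<lambda>i. - ((u $ i - x $ i) * (\<mu> i * y powr (\<mu> i - 1)))"
  \<comment> \<open>Coordinate \<open>i\<close> of \<open>u - ?z y\<close> is
    \<open>(u $ i - x $ i) * y powr \<mu> i\<close>, so \<open>?T\<close> is one term of the Taylor
    polynomial centred at \<open>?z y\<close>. In \<open>?T'\<close> the first part differentiates
    the monomial and the sum differentiates the derivative of \<open>f\<close>.\<close>
  let ?T = "\<lambda>is y. (\<Prod>i\<leftarrow>is. (u $ i - x $ i) * y powr \<mu> i) * iter_partial is f (?z y)"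
  let ?T' = "\<lambda>is. ?P is * ?L is * y powr (?L is - 1) * iter_partial is f (?z y)
       - (\<Sum>i\<in>UNIV. ?P (i # is) * \<mu> i * y powr (?L (i # is) - 1) * iter_partial (i # is) f (?z y))"
  have T: "(?T is has_real_derivative ?T' is) (at y)" if len: "length is < r" for "is"
  proof -
    have "times_cont_diff (length is + Suc 0) f"
      by (rule times_cont_diff_le[OF f]) (use len in simp)
    then have "times_cont_diff (Suc 0) (iter_partial is f)"
      by (rule times_cont_diff_iter_partial)
    then have d: "iter_partial is f differentiable (at (?z y))" by simp
    have "((\<lambda>y. iter_partial is f (?z y)) has_real_derivative
        (\<Sum>i\<in>UNIV. ?z' i * partial_deriv i (iter_partial is f) (?z y))) (at y)"
      by (rule has_real_derivative_along_curve[where f = "iter_partial is f" and z = ?z, OF d])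
         (use y in \<open>auto intro!: derivative_eq_intros\<close>)
    from DERIV_mult[OF has_real_derivative_prod_list_powr[OF y] this]
    have "(?T is has_real_derivative ?P is * ?L is * y powr (?L is - 1) * iter_partial is f (?z y)
       + (\<Sum>i\<in>UNIV. ?z' i * partial_deriv i (iter_partial is f) (?z y)) * (\<Prod>i\<leftarrow>is. (u $ i - x $ i) * y powr \<mu> i)) (at y)"
      .
    also have "(\<Sum>i\<in>UNIV. ?z' i * partial_deriv i (iter_partial is f) (?z y)) * (\<Prod>i\<leftarrow>is. (u $ i - x $ i) * y powr \<mu> i)
      = - (\<Sum>i\<in>UNIV. ?P (i # is) * \<mu> i * y powr (?L (i # is) - 1) * iter_partial (i # is) f (?z y))"
      unfolding sum_distrib_right sum_negf[symmetric] prod_list_powr_eq[OF y]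
    proof (rule sum.cong[OF refl])
      fix i
      have "y powr (?L (i # is) - 1) = y powr (\<mu> i - 1) * y powr ?L is"
        using y by (simp add: algebra_simps flip: powr_add)
      then show "?z' i * partial_deriv i (iter_partial is f) (?z y) * (?P is * y powr ?L is) =
        - (?P (i # is) * \<mu> i * y powr (?L (i # is) - 1) * iter_partial (i # is) f (?z y))"
        by simp
    qed
    finally show ?thesis by simp
  qed
  have "((\<lambda>y. \<Sum>\<nu><r. (\<Sum>is | length is = \<nu>. ?T is y) / fact \<nu>) has_real_derivative
      (\<Sum>\<nu><r. (\<Sum>is | length is = \<nu>. ?T' is) / fact \<nu>)) (at y)"
    by (intro DERIV_sum DERIV_cdivide T) auto
  moreover have "(\<Sum>is | length is = \<nu>. ?T' is) / fact \<nu> = A \<nu> - A (Suc \<nu>)" if "\<nu> < r" for \<nu>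
  proof -
    let ?G = "\<lambda>is. ?P is * y powr (?L is - 1) * iter_partial is f (?z y)"
    have sym: "\<mu> a * ?G is = \<mu> a * ?G js" if "mset is = mset js" "length is = Suc \<nu>" for a "is" js
    proof -
      have "iter_partial is f = iter_partial js f"
        by (rule iter_partial_mset_cong[OF that(1) times_cont_diff_le[OF f]]) (use that(2) \<open>\<nu> < r\<close> in simp)
      moreover have "?L is = ?L js" by (simp only: mset_map that(1) flip: sum_mset_sum_list)
      moreover have "?P is = ?P js" by (simp only: mset_map that(1) flip: prod_mset_prod_list)
      ultimately show ?thesis by simp
    qed
    \<comment> \<open>Prepending \<open>i\<close> gives a tuple of length \<open>Suc \<nu>\<close>,
      weighted by the exponent of its first index. Averaging over the positions replaces that weight
      by \<open>?L is / Suc \<nu>\<close>, and the new denominator turns \<open>fact \<nu>\<close>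
      into \<open>fact (Suc \<nu>)\<close>.\<close>
    have "(\<Sum>is | length is = \<nu>. \<Sum>i\<in>UNIV. ?P (i # is) * \<mu> i * y powr (?L (i # is) - 1) * iter_partial (i # is) f (?z y))
        = (\<Sum>is | length is = Suc \<nu>. \<mu> (is ! 0) * ?G is)"
      unfolding sum_lists_Suc by (simp add: mult_ac)
    also have "\<dots> = (\<Sum>is | length is = Suc \<nu>. \<Sum>j<Suc \<nu>. \<mu> (is ! j) * ?G is) / real (Suc \<nu>)"
      using sum_lists_nth_eq_first[of "Suc \<nu>" "\<lambda>a is. \<mu> a * ?G is", OF sym] by simp
    also have "(\<Sum>is | length is = Suc \<nu>. \<Sum>j<Suc \<nu>. \<mu> (is ! j) * ?G is) = (\<Sum>is | length is = Suc \<nu>. ?L is * ?G is)"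
      by (rule sum.cong) (simp_all add: sum_list_sum_nth atLeast0LessThan sum_distrib_right del: sum.lessThan_Suc)
    finally show ?thesis
      unfolding A_def sum_subtractf by (simp add: diff_divide_distrib mult_ac)
  qed
  ultimately have "((\<lambda>y. \<Sum>\<nu><r. (\<Sum>is | length is = \<nu>. ?T is y) / fact \<nu>) has_real_derivative
      (\<Sum>\<nu><r. A \<nu> - A (Suc \<nu>))) (at y)"
    by simp
  \<comment> \<open>The boundary term \<open>A 0\<close> vanishes because the exponents of the empty
    tuple sum to 0.\<close>
  moreover have "(\<Sum>\<nu><r. A \<nu> - A (Suc \<nu>)) = - A r"
    unfolding sum_lessThan_telescope' by (simp add: A_def)
  moreover have "(\<lambda>y. taylor_list r f (?z y) u) = (\<lambda>y. \<Sum>\<nu><r. (\<Sum>is | length is = \<nu>. ?T is y) / fact \<nu>)"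
    by (simp add: taylor_list_def)
  ultimately show ?thesis by metis
qed

lemma one_less_sum_list: "is \<noteq> [] \<Longrightarrow> (\<And>i. \<mu> i > 1) \<Longrightarrow> (\<Sum>i\<leftarrow>is. \<mu> i) > (1::real)"
proof (induction "is" rule: list_nonempty_induct)
  case (cons i "is")
  have "1 < \<mu> i" by (rule cons.prems)
  moreover have "1 < (\<Sum>i\<leftarrow>is. \<mu> i)" by (rule cons.IH[OF cons.prems])
  ultimately show ?case by simp
qed simp

text \<open>The interior form of the fundamental theorem admits \<open>a = 0\<close>, where
  \<open>y powr L\<close> is continuous but may fail to be differentiable. Between 0 and 1 the
  integral is 1, so the integrand is a probability density.\<close>

lemma has_integral_powr_density:
  fixes a b L :: real
  assumes "0 < L" "0 \<le> a" "a \<le> b"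
  shows "((\<lambda>y. L * y powr (L - 1)) has_integral (b powr L - a powr L)) {a..b}"
proof (rule fundamental_theorem_of_calculus_interior)
  show "continuous_on {a..b} (\<lambda>y. y powr L)"
    using assms by (intro continuous_on_subset[OF continuous_on_powr_const[of L b]]) auto
  fix y assume "y \<in> {a<..<b}"
  then have "((\<lambda>y. y powr L) has_real_derivative L * y powr (L - 1)) (at y)"
    using assms by (auto intro!: derivative_eq_intros)
  then show "((\<lambda>y. y powr L) has_vector_derivative L * y powr (L - 1)) (at y)"
    by (rule has_real_derivative_iff_has_vector_derivative[THEN iffD1])
qed (fact assms)

text \<open>The function \<open>H\<close> in the proof runs from \<open>f u\<close> at 0 to the
  Taylor polynomial of order r - 1 centred at \<open>x\<close> at 1. Since each weight has mass 1,
  the terms of order r can be moved under the integral. Exponents above 1 make the weights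
  continuous at 0.\<close>

lemma taylor_remainder_integral:
  fixes f :: "real ^ 'n::{finite,linorder} \<Rightarrow> real" and \<mu> :: "'n \<Rightarrow> real"
  assumes r: "r \<ge> 1" and f: "times_cont_diff r f" and \<mu>: "\<And>i. \<mu> i > 1"
  defines "L \<equiv> \<lambda>is. \<Sum>i\<leftarrow>is. \<mu> i"
  shows "taylor_remainder r f x u = (\<Sum>is | length is = r. (\<Prod>i\<leftarrow>is. u $ i - x $ i) *
      integral {0..1} (\<lambda>y. L is * y powr (L is - 1) *
        (iter_partial is f (power_curve \<mu> x u y) - iter_partial is f x))) / fact r"
proof -
  let ?z = "power_curve \<mu> x u" and ?S = "{is :: 'n list. length is = r}"
  let ?P = "\<lambda>is. \<Prod>i\<leftarrow>is. u $ i - x $ i"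
  let ?w = "\<lambda>is y. L is * y powr (L is - 1)"
  have \<mu>0: "\<mu> i > 0" for i using \<mu>[of i] by simp
  have L: "L is > 1" if "length is = r" for "is"
    unfolding L_def by (rule one_less_sum_list) (use that r \<mu> in auto)
  have cont: "continuous_on UNIV (iter_partial is f)" if "length is \<le> r" for "is"
  proof -
    have "times_cont_diff (length is + (r - length is)) f" using f that by simp
    then show ?thesis by (rule times_cont_diff_imp_continuous[OF times_cont_diff_iter_partial])
  qed
  have contz: "continuous_on {0..1} (\<lambda>y. iter_partial is f (?z y))" if "length is \<le> r" for "is"
    by (rule continuous_on_compose_power_curve[OF \<mu>0 cont[OF that]])
  have int: "(\<lambda>y. ?w is y * iter_partial is f (?z y)) integrable_on {0..1}" if "is \<in> ?S" for "is"
    using that L[of "is"]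
    by (intro integrable_continuous_interval continuous_intros contz continuous_on_powr_const) auto
  define A where "A = (\<lambda>y. (\<Sum>is | length is = r. ?P is * L is * y powr (L is - 1) * iter_partial is f (?z y)) / fact r)"
  define H where "H = (\<lambda>y. taylor_list r f (?z y) u)"
  have "((\<lambda>y. - A y) has_integral H 1 - H 0) {0..1}"
  proof (rule fundamental_theorem_of_calculus_interior)
    have prod: "continuous_on {0..1} (\<lambda>y. \<Prod>i\<leftarrow>is. u $ i - ?z y $ i)" for "is"
      by (induction "is") (auto intro!: continuous_intros continuous_on_powr_const \<mu>0)
    show "continuous_on {0..1} H"
      unfolding H_def taylor_list_def by (intro continuous_intros prod contz) auto
    fix y :: real assume "y \<in> {0<..<1}"
    then have "(H has_real_derivative - A y) (at y)"
      unfolding H_def A_def L_def by (intro has_real_derivative_taylor_list_power_curve[OF f]) simp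
    then show "(H has_vector_derivative - A y) (at y)"
      by (rule has_real_derivative_iff_has_vector_derivative[THEN iffD1])
  qed simp
  from has_integral_neg[OF this] have A1: "(A has_integral H 0 - H 1) {0..1}"
    by simp
  have A2: "(A has_integral (\<Sum>is\<in>?S. ?P is * integral {0..1} (\<lambda>y. ?w is y * iter_partial is f (?z y))) / fact r) {0..1}"
  proof -
    have "((\<lambda>y. \<Sum>is\<in>?S. ?P is * (?w is y * iter_partial is f (?z y))) has_integral
        (\<Sum>is\<in>?S. ?P is * integral {0..1} (\<lambda>y. ?w is y * iter_partial is f (?z y)))) {0..1}"
      by (intro has_integral_sum finite_lists_of_length has_integral_mult_right integrable_integral int)
    from has_integral_divide[OF this, of "fact r"] show ?thesis
      by (simp add: A_def mult_ac)
  qed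
  have eq: "f u - taylor_list r f x u =
      (\<Sum>is\<in>?S. ?P is * integral {0..1} (\<lambda>y. ?w is y * iter_partial is f (?z y))) / fact r"
    using has_integral_unique[OF A1 A2] by (simp only: H_def power_curve_0 power_curve_1 taylor_list_at_self[OF r])
  have split: "integral {0..1} (\<lambda>y. ?w is y * (iter_partial is f (?z y) - iter_partial is f x))
      = integral {0..1} (\<lambda>y. ?w is y * iter_partial is f (?z y)) - iter_partial is f x" if "is \<in> ?S" for "is"
  proof (rule integral_unique)
    have "((?w is) has_integral 1) {0..1}"
      using has_integral_powr_density[of "L is" 0 1] L[of "is"] that by simp
    from has_integral_diff[OF integrable_integral[OF int[OF that]] has_integral_mult_left[OF this, of "iter_partial is f x"]]
    show "((\<lambda>y. ?w is y * (iter_partial is f (?z y) - iter_partial is f x)) has_integral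
        integral {0..1} (\<lambda>y. ?w is y * iter_partial is f (?z y)) - iter_partial is f x) {0..1}"
      by (simp add: right_diff_distrib)
  qed
  have "(\<Sum>is\<in>?S. ?P is * integral {0..1} (\<lambda>y. ?w is y * (iter_partial is f (?z y) - iter_partial is f x)))
      = (\<Sum>is\<in>?S. ?P is * integral {0..1} (\<lambda>y. ?w is y * iter_partial is f (?z y)))
        - (\<Sum>is\<in>?S. ?P is * iter_partial is f x)"
    unfolding sum_subtractf[symmetric]
    by (rule sum.cong[OF refl], subst split, assumption, rule right_diff_distrib)
  then show ?thesis
    unfolding taylor_remainder_eq[OF f] eq by (simp only: diff_divide_distrib)
qed

subsection \<open>Inequalities for geometric means\<close>

lemma exp_tangent: "exp c * (1 + (y - c)) \<le> exp (y :: real)"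
proof -
  have "exp c * (1 + (y - c)) \<le> exp c * exp (y - c)"
    by (intro mult_left_mono exp_ge_add_one_self) auto
  then show ?thesis by (simp flip: exp_add)
qed

text \<open>AM-GM inequality for the number 1 and the numbers \<open>exp x\<close>: the tangents to
  \<open>exp\<close> at the mean of the exponents are added up, and their linear parts
  cancel.\<close>

lemma am_gm_exp:
  fixes xs :: "real list"
  shows "(real (length xs) + 1) * exp (sum_list xs / (real (length xs) + 1)) \<le> 1 + (\<Sum>x\<leftarrow>xs. exp x)"
proof -
  define n where "n = real (length xs) + 1"
  define c where "c = sum_list xs / n"
  have n: "n > 0" by (simp add: n_def)
  have "exp c * (1 + (0 - c)) + (\<Sum>x\<leftarrow>xs. exp c * (1 + (x - c))) \<le> exp 0 + (\<Sum>x\<leftarrow>xs. exp x)"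
    by (intro add_mono exp_tangent sum_list_mono)
  moreover have "(\<Sum>x\<leftarrow>xs. exp c * (1 + (x - c))) = exp c * (real (length xs) * (1 - c) + sum_list xs)"
    by (induction xs) (auto simp: algebra_simps)
  moreover have "(1 + (0 - c)) + (real (length xs) * (1 - c) + sum_list xs) = n"
  proof -
    have "sum_list xs = n * c" using n by (simp add: c_def)
    then show ?thesis by (simp add: n_def algebra_simps)
  qed
  ultimately have "exp c * n \<le> 1 + (\<Sum>x\<leftarrow>xs. exp x)"
    by (metis distrib_left exp_zero)
  then show ?thesis by (simp add: n_def c_def mult.commute)
qed

definition geo_mean :: "real list \<Rightarrow> real" where
  "geo_mean as = exp ((\<Sum>a\<leftarrow>as. ln a) / real (length as))"

lemma geo_mean_pos: "0 < geo_mean as"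
  by (simp add: geo_mean_def)

lemma geo_mean_power:
  assumes "as \<noteq> []" "\<And>a. a \<in> set as \<Longrightarrow> 0 < a"
  shows "geo_mean as ^ length as = prod_list as"
proof -
  have "prod_list as = exp (\<Sum>a\<leftarrow>as. ln a)"
    using assms(2) by (induction as) (auto simp: exp_add)
  then show ?thesis
    using assms(1) by (simp add: geo_mean_def flip: exp_of_nat_mult)
qed

text \<open>For \<open>c = 1\<close> both sides agree when \<open>d\<close> and all entries of \<open>as\<close> coincide; only with this exponent \<open>m\<close>
  is that point stationary in \<open>d\<close>.\<close>

lemma weighted_rate_le_geo_mean:
  fixes as :: "real list" and c d S :: real
  assumes as: "as \<noteq> []" "\<And>a. a \<in> set as \<Longrightarrow> 0 < a" and d: "0 < d" and S: "0 < S" and c: "0 < c"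
  defines "r \<equiv> real (length as)"
  defines "m \<equiv> 1 + 1 / r"
  shows "d * ((S / d) powr m / (c * (\<Sum>a\<leftarrow>as. (S / a) powr m) + (S / d) powr m))
    \<le> c powr (- (r / (r + 1))) * geo_mean as / (r + 1)"
proof -
  \<comment> \<open>After division by \<open>(S / d) powr m\<close> the denominator becomes
    \<open>?E\<close>; thus the left side is \<open>d / ?E\<close> and \<open>S\<close>
    cancels.\<close>
  define xs where "xs = map (\<lambda>a. ln c + m * (ln d - ln a)) as"
  let ?E = "1 + (\<Sum>x\<leftarrow>xs. exp x)"
  have r: "r > 0" using as(1) by (simp add: r_def)
  have len: "length xs = length as" by (simp add: xs_def)
  have "sum_list xs = r * ln c + m * (r * ln d - (\<Sum>a\<leftarrow>as. ln a))"
    unfolding xs_def r_def by (induction as) (auto simp: algebra_simps)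
  \<comment> \<open>Since m = (r + 1) / r, the coefficient of \<open>ln d\<close> is exactly 1,
    which lets \<open>d\<close> cancel in the final bound.\<close>
  also have "\<dots> / (r + 1) = r / (r + 1) * ln c + (ln d - (\<Sum>a\<leftarrow>as. ln a) / r)"
    using r by (simp add: m_def field_simps)
  finally have "exp (sum_list xs / (r + 1)) = c powr (r / (r + 1)) * d / geo_mean as"
    using c d by (simp add: geo_mean_def r_def[symmetric] powr_def exp_add exp_diff)
  with am_gm_exp[of xs] have E: "(r + 1) * (c powr (r / (r + 1)) * d / geo_mean as) \<le> ?E"
    by (simp add: len r_def)
  have "(S / d) powr m * (\<Sum>x\<leftarrow>xs. exp x) = c * (\<Sum>a\<leftarrow>as. (S / a) powr m)"
    using as(2) unfolding xs_def
  proof (induction as)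
    case (Cons a as)
    have "0 < a" using Cons.prems by simp
    have "(S / d) powr m * exp (ln c + m * (ln d - ln a)) = exp (m * (ln S - ln d) + (ln c + m * (ln d - ln a)))"
      unfolding exp_add[of "m * (ln S - ln d)"] using S d by (simp add: powr_def ln_div)
    also have "m * (ln S - ln d) + (ln c + m * (ln d - ln a)) = ln c + m * (ln S - ln a)"
      by (simp add: algebra_simps)
    also have "exp \<dots> = c * (S / a) powr m"
      unfolding exp_add using S c \<open>0 < a\<close> by (simp add: powr_def ln_div)
    finally have "(S / d) powr m * exp (ln c + m * (ln d - ln a)) = c * (S / a) powr m" .
    moreover have "\<And>a. a \<in> set as \<Longrightarrow> 0 < a" using Cons.prems by simp
    ultimately show ?case using Cons.IH by (simp add: distrib_left)
  qed simp
  then have "c * (\<Sum>a\<leftarrow>as. (S / a) powr m) + (S / d) powr m = (S / d) powr m * ?E"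
    by (simp only: distrib_left mult_1_right add.commute)
  then have "(S / d) powr m / (c * (\<Sum>a\<leftarrow>as. (S / a) powr m) + (S / d) powr m) = 1 / ?E"
    using d S by simp
  moreover have "d * (1 / ?E) \<le> d * (1 / ((r + 1) * (c powr (r / (r + 1)) * d / geo_mean as)))"
    using E d c r geo_mean_pos[of as]
    by (intro mult_left_mono divide_left_mono mult_pos_pos divide_pos_pos) (auto intro: less_le_trans[OF _ E] intro!: add_pos_nonneg sum_list_nonneg)
  moreover have "d * (1 / ((r + 1) * (c powr (r / (r + 1)) * d / geo_mean as)))
      = c powr (- (r / (r + 1))) * geo_mean as / (r + 1)"
  proof -
    have "d * (1 / (R * (k * d / G))) = 1 / k * G / R" if "0 < k" "0 < R" "0 < G" for k R G :: real
      using d that by (simp add: field_simps)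
    then show ?thesis
      unfolding powr_minus_divide using c r geo_mean_pos[of as] by simp
  qed
  ultimately show ?thesis by simp
qed

text \<open>The worst case is \<open>r = 1\<close>, with value 1 / sqrt 2; the constant 5 / 7 is a
  rational bound for it.\<close>

lemma two_powr_le_5_7:
  assumes "1 \<le> r"
  shows "2 powr (- (r / (r + 1))) \<le> (5 / 7 :: real)"
proof -
  have "2 powr (- (r / (r + 1))) \<le> 2 powr (- (1 / 2 :: real))"
    using assms by (intro powr_mono) (auto simp: field_simps)
  also have "\<dots> = 1 / sqrt 2" by (simp add: powr_minus_divide powr_half_sqrt)
  also have "7 / 5 \<le> sqrt (2 :: real)" by (rule real_le_rsqrt) (simp add: power2_eq_square)
  then have "1 / sqrt 2 \<le> (5 / 7 :: real)" by (simp add: field_simps)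
  finally show ?thesis .
qed

section \<open>Lower bounds for truncated linear functions and for concave functions\<close>

lemma power_eq_exp: "0 < t \<Longrightarrow> t ^ n = exp (real n * ln t)" for t :: real
  by (simp add: exp_of_nat_mult)

text \<open>This is what \<open>power_min_5_7_ge\<close> needs at \<open>r = 1\<close>. It follows
  by raising \<open>exp (- 1 / 20) \<ge> 19 / 20\<close> to the power 20.\<close>

lemma exp_1_le: "exp 1 \<le> (14 / 5 :: real)"
proof -
  have "5 / 14 \<le> (19 / 20 :: real) ^ 20" by (simp add: power_divide)
  also have "\<dots> \<le> exp (- 1 / 20) ^ 20"
    using exp_ge_add_one_self[of "- 1 / 20 :: real"] by (intro power_mono) auto
  also have "\<dots> = exp (- 1)" by (simp flip: exp_of_nat_mult)
  finally show ?thesis by (simp add: exp_minus field_simps)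
qed

text \<open>The next two bounds come from the tangents to \<open>exp\<close> at \<open>- 1 / r\<close> and at \<open>1 / (r + 1)\<close>.\<close>

lemma power_min_5_7_ge:
  fixes t :: real
  assumes t: "0 < t" and r: "r \<ge> 1"
  shows "5 / 7 * (1 + real r * ln t) \<le> t ^ r * min t (5 / 7)"
proof -
  have r': "real r > 0" "real r \<ge> 1" using r by auto
  have 1: "5 / 7 * (1 + real r * ln t) \<le> t ^ r * (5 / 7)"
    unfolding power_eq_exp[OF t] mult.commute[of _ "5 / 7"]
    by (intro mult_left_mono exp_ge_add_one_self) auto
  have "5 / 7 * (1 + real r * ln t) \<le> t ^ (r + 1)"
  proof (cases "1 + real r * ln t \<le> 0")
    case True
    then have "5 / 7 * (1 + real r * ln t) \<le> 0" by (intro mult_nonneg_nonpos) auto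
    also have "0 \<le> t ^ (r + 1)" using t by simp
    finally show ?thesis .
  next
    case False
    \<comment> \<open>The tangent to \<open>exp\<close> at - 1 / r, evaluated at (r + 1) ln t,
      vanishes together with 1 + r ln t. Hence only slopes must be compared, and the chord of
      \<open>exp\<close> over the unit interval gives the required bound on
      \<open>exp (1 / r)\<close>.\<close>
    have "exp (1 / real r) = exp ((1 - 1 / real r) *\<^sub>R 0 + (1 / real r) *\<^sub>R 1)" by simp
    also have "\<dots> \<le> (1 - 1 / real r) * exp 0 + (1 / real r) * exp 1"
      using exp_convex r' by (intro convex_onD[of UNIV exp]) auto
    also have "\<dots> \<le> (1 - 1 / real r) + (1 / real r) * (14 / 5)"
      using exp_1_le r' by (intro add_mono mult_left_mono) auto
    also have "\<dots> \<le> 7 / 5 * (1 + 1 / real r)" using r' by (simp add: field_simps)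
    finally have "5 / 7 * exp (1 / real r) \<le> 1 + 1 / real r" by simp
    then have "5 / 7 \<le> exp (- 1 / real r) * (1 + 1 / real r)"
      by (simp add: exp_minus field_simps)
    then have "5 / 7 * (1 + real r * ln t) \<le> exp (- 1 / real r) * (1 + 1 / real r) * (1 + real r * ln t)"
      using False by (intro mult_right_mono) auto
    also have "\<dots> = exp (- 1 / real r) * (1 + (real (r + 1) * ln t - (- 1 / real r)))"
      using r' by (simp add: field_simps)
    also have "\<dots> \<le> exp (real (r + 1) * ln t)" by (rule exp_tangent)
    finally show ?thesis by (simp only: power_eq_exp[OF t])
  qed
  with 1 show ?thesis by (simp add: min_def mult.commute)
qed

lemma power_min_9_7_ge:
  fixes t :: real
  assumes t: "0 < t" and r: "r \<ge> 1"
  shows "1 + (real r + 1) * ln t \<le> t ^ r * min t (9 / 7)"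
proof -
  have r': "real r > 0" "real r \<ge> 1" using r by auto
  have 1: "1 + (real r + 1) * ln t \<le> t ^ (r + 1)"
    using exp_ge_add_one_self[of "real (r + 1) * ln t"] unfolding power_eq_exp[OF t]
    by (simp only: of_nat_add of_nat_1)
  have "1 + (real r + 1) * ln t \<le> t ^ r * (9 / 7)"
  proof (cases "1 + (real r + 1) * ln t \<le> 0")
    case True
    moreover have "0 \<le> t ^ r * (9 / 7)" using t by simp
    ultimately show ?thesis by linarith
  next
    case False
    \<comment> \<open>The tangent to \<open>exp\<close> at \<open>w\<close>, evaluated at r ln t, is
      \<open>exp w * (1 - w)\<close> times 1 + (r + 1) ln t. It remains to bound this factor below
      by 7 / 9 for \<open>w \<le> 1 / 2\<close>.\<close>
    define w where "w = 1 / (real r + 1)"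
    have w: "0 < w" "w \<le> 1 / 2" using r' by (auto simp: w_def field_simps)
    have "w ^ 2 \<le> (1 / 2) ^ 2" "w ^ 3 \<le> (1 / 2) ^ 3" using w by (simp_all only: power_mono less_imp_le)
    moreover have "(1 + w + w\<^sup>2 / 2) * (1 - w) = 1 - w ^ 2 / 2 - w ^ 3 / 2"
      by (simp add: field_simps power2_eq_square power3_eq_cube)
    ultimately have "7 / 9 \<le> (1 + w + w\<^sup>2 / 2) * (1 - w)"
      by (simp add: power_divide)
    also have "\<dots> \<le> exp w * (1 - w)"
      using w exp_lower_Taylor_quadratic[of w] by (intro mult_right_mono) auto
    finally have "1 \<le> 9 / 7 * (exp w * (1 - w))" by simp
    then have "1 + (real r + 1) * ln t \<le> 9 / 7 * (exp w * (1 - w)) * (1 + (real r + 1) * ln t)"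
      using False mult_right_mono[of 1 "9 / 7 * (exp w * (1 - w))" "1 + (real r + 1) * ln t"] by simp
    also have "\<dots> = 9 / 7 * (exp w * (1 + (real r * ln t - w)))"
    proof -
      have "(1 - w) * (1 + (real r + 1) * ln t) = 1 + (real r * ln t - w)"
        using r' by (simp add: w_def field_simps)
      then show ?thesis by (simp only: mult.assoc)
    qed
    also have "\<dots> \<le> 9 / 7 * exp (real r * ln t)"
      by (intro mult_left_mono exp_tangent) auto
    finally show ?thesis by (simp only: power_eq_exp[OF t] mult.commute)
  qed
  with 1 show ?thesis by (simp add: min_def mult.commute)
qed

text \<open>The combination is piecewise linear through the origin and the points of the graph over
  \<open>p\<close> and \<open>q\<close>, and constant beyond \<open>q\<close>. Concavity with
  \<open>0 \<le> \<omega> 0\<close> puts \<open>\<omega>\<close> above it up to \<open>q\<close>,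
  monotonicity beyond. Here \<open>\<beta>\<close> is the slope between \<open>p\<close> and
  \<open>q\<close>, and \<open>\<alpha>\<close> is the drop of slope at \<open>p\<close>.\<close>

lemma concave_ge_two_kinks:
  fixes \<omega> :: "real \<Rightarrow> real"
  assumes conc: "concave_on {0..} \<omega>" and nonneg: "0 \<le> \<omega> 0"
    and mono: "\<And>s t. 0 \<le> s \<Longrightarrow> s \<le> t \<Longrightarrow> \<omega> s \<le> \<omega> t"
    and pq: "0 < p" "p < q"
  obtains \<alpha> \<beta> where "0 \<le> \<alpha>" "0 \<le> \<beta>" "\<omega> p = (\<alpha> + \<beta>) * p" "\<omega> q = \<alpha> * p + \<beta> * q"
    "\<And>t. 0 \<le> t \<Longrightarrow> \<alpha> * min t p + \<beta> * min t q \<le> \<omega> t"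
proof -
  define \<beta> where "\<beta> = (\<omega> q - \<omega> p) / (q - p)"
  define \<alpha> where "\<alpha> = \<omega> p / p - \<beta>"
  have interp: "(1 - l) * \<omega> a + l * \<omega> b \<le> \<omega> ((1 - l) * a + l * b)"
    if "0 \<le> a" "0 \<le> b" "0 \<le> l" "l \<le> 1" for a b l
    using conc that unfolding concave_on_iff by auto
  have \<beta>: "0 \<le> \<beta>" using mono[of p q] pq by (simp add: \<beta>_def)
  have eqs: "\<omega> p = (\<alpha> + \<beta>) * p" "\<omega> q - \<omega> p = \<beta> * (q - p)"
    using pq by (simp_all add: \<alpha>_def \<beta>_def)
  then have eq: "\<omega> q = \<alpha> * p + \<beta> * q" by (simp add: algebra_simps)
  have below: "t / b * \<omega> b \<le> \<omega> t" if "0 \<le> t" "t \<le> b" "0 < b" for t b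
  proof -
    have "0 \<le> (1 - t / b) * \<omega> 0" using that nonneg by simp
    then show ?thesis using interp[of 0 b "t / b"] that by simp
  qed
  have "p / q * \<omega> q \<le> \<omega> p" using below[of p q] pq by simp
  then have "p * (\<alpha> * p + \<beta> * q) \<le> q * ((\<alpha> + \<beta>) * p)" using pq eq eqs(1) by (simp add: field_simps)
  then have "0 \<le> \<alpha> * (p * (q - p))" by (simp add: algebra_simps)
  moreover have "0 < p * (q - p)" using pq by simp
  ultimately have \<alpha>: "0 \<le> \<alpha>" using zero_le_mult_iff[of \<alpha> "p * (q - p)"] by linarith
  have "\<alpha> * min t p + \<beta> * min t q \<le> \<omega> t" if t: "0 \<le> t" for t
  proof -
    consider "t \<le> p" | "p \<le> t" "t \<le> q" | "q \<le> t" by linarith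
    then show ?thesis
    proof cases
      case 1
      then show ?thesis using below[of t p] t pq eqs(1) by (simp add: algebra_simps)
    next
      case 2
      define l where "l = (t - p) / (q - p)"
      have l: "0 \<le> l" "l \<le> 1" "l * (q - p) = t - p" using 2 pq by (auto simp: l_def)
      then have "(1 - l) * p + l * q = t" by (simp add: algebra_simps)
      then have "(1 - l) * \<omega> p + l * \<omega> q \<le> \<omega> t" using interp[of p q l] l pq by simp
      moreover have "(1 - l) * \<omega> p + l * \<omega> q = \<omega> p + l * (\<omega> q - \<omega> p)"
        by (simp add: algebra_simps)
      then have "(1 - l) * \<omega> p + l * \<omega> q = \<omega> p + \<beta> * (l * (q - p))"
        unfolding eqs(2) by (simp only: mult.left_commute)
      ultimately have "\<omega> p + \<beta> * (t - p) \<le> \<omega> t" unfolding l(3) by linarith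
      then show ?thesis using 2 eqs(1) by (simp add: algebra_simps)
    next
      case 3
      then show ?thesis using mono[of q t] pq eq by simp
    qed
  qed
  with \<alpha> \<beta> eqs(1) eq show ?thesis by (rule that)
qed

text \<open>Each summand has a lower bound affine in \<open>ln a - ln \<Gamma>\<close>. These
  differences add up to 0, so only the constant terms survive the summation.\<close>

lemma geo_mean_concave_le:
  fixes \<omega> :: "real \<Rightarrow> real" and as :: "real list"
  assumes conc: "concave_on {0..} \<omega>" and nonneg: "0 \<le> \<omega> 0"
    and mono: "\<And>s t. 0 \<le> s \<Longrightarrow> s \<le> t \<Longrightarrow> \<omega> s \<le> \<omega> t"
    and as: "as \<noteq> []" "\<And>a. a \<in> set as \<Longrightarrow> 0 < a"
  defines "r \<equiv> length as" and "\<Gamma> \<equiv> geo_mean as"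
  shows "real r * (\<Gamma> ^ r * ((\<omega> (5 / 7 * \<Gamma>) + \<omega> (9 / 7 * \<Gamma>)) / 2)) \<le> (\<Sum>a\<leftarrow>as. a ^ r * \<omega> a)"
proof -
  have r: "r \<ge> 1" using as(1) by (cases as) (auto simp: r_def)
  have \<Gamma>: "0 < \<Gamma>" unfolding \<Gamma>_def by (rule geo_mean_pos)
  obtain \<alpha> \<beta> where ab: "0 \<le> \<alpha>" "0 \<le> \<beta>" "\<omega> (5 / 7 * \<Gamma>) = (\<alpha> + \<beta>) * (5 / 7 * \<Gamma>)"
      "\<omega> (9 / 7 * \<Gamma>) = \<alpha> * (5 / 7 * \<Gamma>) + \<beta> * (9 / 7 * \<Gamma>)"
    and kinks: "\<And>t. 0 \<le> t \<Longrightarrow> \<alpha> * min t (5 / 7 * \<Gamma>) + \<beta> * min t (9 / 7 * \<Gamma>) \<le> \<omega> t"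
    by (rule concave_ge_two_kinks[OF conc nonneg mono, of "5 / 7 * \<Gamma>" "9 / 7 * \<Gamma>"]) (use \<Gamma> in auto)
  let ?l = "\<lambda>a. ln a - ln \<Gamma>"
  have pointwise: "\<Gamma> ^ (r + 1) * (\<alpha> * (5 / 7 * (1 + real r * ?l a)) + \<beta> * (1 + (real r + 1) * ?l a)) \<le> a ^ r * \<omega> a"
    if "0 < a" for a
  proof -
    define t where "t = a / \<Gamma>"
    have t: "0 < t" "a = \<Gamma> * t" "?l a = ln t" using that \<Gamma> by (auto simp: t_def ln_div)
    have "\<alpha> * (5 / 7 * (1 + real r * ln t)) + \<beta> * (1 + (real r + 1) * ln t)
        \<le> \<alpha> * (t ^ r * min t (5 / 7)) + \<beta> * (t ^ r * min t (9 / 7))"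
      by (intro add_mono mult_left_mono power_min_5_7_ge power_min_9_7_ge t r ab)
    then have "\<Gamma> ^ (r + 1) * (\<alpha> * (5 / 7 * (1 + real r * ln t)) + \<beta> * (1 + (real r + 1) * ln t))
        \<le> \<Gamma> ^ (r + 1) * (\<alpha> * (t ^ r * min t (5 / 7)) + \<beta> * (t ^ r * min t (9 / 7)))"
      using \<Gamma> by (intro mult_left_mono) auto
    also have "\<dots> = a ^ r * (\<alpha> * (\<Gamma> * min t (5 / 7)) + \<beta> * (\<Gamma> * min t (9 / 7)))"
      by (simp add: t(2) power_mult_distrib algebra_simps)
    also have "\<dots> = a ^ r * (\<alpha> * min a (5 / 7 * \<Gamma>) + \<beta> * min a (9 / 7 * \<Gamma>))"
      using \<Gamma> by (simp add: t(2) min_mult_distrib_left mult.commute)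
    also have "\<dots> \<le> a ^ r * \<omega> a"
      using that by (intro mult_left_mono kinks) auto
    finally show ?thesis by (simp only: t(3))
  qed
  have lnsum: "(\<Sum>a\<leftarrow>as. ?l a) = 0"
  proof -
    have "(\<Sum>a\<leftarrow>as. ?l a) = (\<Sum>a\<leftarrow>as. ln a) - real r * ln \<Gamma>"
      unfolding r_def by (induction as) (auto simp: algebra_simps)
    then show ?thesis using r by (simp add: \<Gamma>_def geo_mean_def r_def)
  qed
  let ?C = "\<Gamma> ^ (r + 1) * (\<alpha> * (5 / 7) + \<beta>)"
  let ?B = "\<Gamma> ^ (r + 1) * (\<alpha> * (5 / 7) * real r + \<beta> * (real r + 1))"
  have affine: "(\<Sum>a\<leftarrow>as. C + B * g a) = real (length as) * C + B * (\<Sum>a\<leftarrow>as. g a)" for B C :: real and g as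
    by (induction as) (auto simp: algebra_simps)
  have "(\<Sum>a\<leftarrow>as. \<Gamma> ^ (r + 1) * (\<alpha> * (5 / 7 * (1 + real r * ?l a)) + \<beta> * (1 + (real r + 1) * ?l a)))
      = (\<Sum>a\<leftarrow>as. ?C + ?B * ?l a)"
    by (simp add: algebra_simps add_divide_distrib diff_divide_distrib)
  also have "\<dots> = real r * ?C" unfolding affine lnsum r_def by simp
  \<comment> \<open>The kinks 5 / 7 and 9 / 7 add up to 2; therefore the mean of the two values of
    \<open>\<omega>\<close> carries \<open>\<beta>\<close> with coefficient exactly
    \<open>\<Gamma>\<close>.\<close>
  also have "\<dots> = real r * (\<Gamma> ^ r * ((\<omega> (5 / 7 * \<Gamma>) + \<omega> (9 / 7 * \<Gamma>)) / 2))"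
    unfolding ab by (simp add: field_simps)
  finally have "real r * (\<Gamma> ^ r * ((\<omega> (5 / 7 * \<Gamma>) + \<omega> (9 / 7 * \<Gamma>)) / 2))
      = (\<Sum>a\<leftarrow>as. \<Gamma> ^ (r + 1) * (\<alpha> * (5 / 7 * (1 + real r * ?l a)) + \<beta> * (1 + (real r + 1) * ?l a)))" ..
  also have "\<dots> \<le> (\<Sum>a\<leftarrow>as. a ^ r * \<omega> a)"
    by (intro sum_list_mono pointwise as)
  finally show ?thesis .
qed

subsection \<open>The K-functional\<close>

lemma abs_le_sup_norm: "bounded (range f) \<Longrightarrow> \<bar>f x\<bar> \<le> sup_norm f"
  unfolding sup_norm_def
  by (rule cSUP_upper) (auto simp: bounded_iff bdd_above_def)

lemma sup_norm_nonneg: "bounded (range f) \<Longrightarrow> 0 \<le> sup_norm f"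
  using abs_le_sup_norm[of f 0] abs_ge_zero[of "f 0"] by linarith

definition gradient_norm :: "(real ^ 'n::finite \<Rightarrow> real) \<Rightarrow> real" where
  "gradient_norm g = (MAX i. sup_norm (partial_deriv i g))"

lemma C_space_1D:
  assumes "g \<in> C_space 1"
  shows "g \<in> C0" "g differentiable (at x)" "bounded (range (partial_deriv i g))"
proof -
  have "iter_partial [i] g \<in> C0"
    using assms unfolding C_space_def by (auto simp del: iter_partial_simps)
  then show "bounded (range (partial_deriv i g))" by (simp add: C0_def)
qed (use assms in \<open>auto simp: C_space_def\<close>)

lemma abs_partial_deriv_le_gradient_norm:
  assumes "g \<in> C_space 1"
  shows "\<bar>partial_deriv i g x\<bar> \<le> gradient_norm g"
proof -
  have "\<bar>partial_deriv i g x\<bar> \<le> sup_norm (partial_deriv i g)"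
    by (rule abs_le_sup_norm[OF C_space_1D(3)[OF assms]])
  also have "\<dots> \<le> gradient_norm g"
    unfolding gradient_norm_def by (rule Max_ge) auto
  finally show ?thesis .
qed

lemma gradient_norm_nonneg: "g \<in> C_space 1 \<Longrightarrow> 0 \<le> gradient_norm g"
  using abs_partial_deriv_le_gradient_norm[of g undefined 0] by linarith

text \<open>Provides a competitor, so that the infimum in \<open>K_functional_greatest\<close> is
  over a nonempty set.\<close>

lemma zero_in_C_space_1: "(\<lambda>_ :: real ^ 'n::finite. 0) \<in> C_space 1"
proof -
  have *: "partial_deriv i (\<lambda>_. 0) = (\<lambda>_. 0)" for i :: 'n by (simp add: partial_deriv_def fun_eq_iff)
  have "(\<lambda>_ :: real ^ 'n. 0) \<in> C0" by (auto simp: C0_def uniformly_continuous_on_def)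
  moreover have "iter_partial is (\<lambda>_. 0) = (\<lambda>_. 0)" for "is" :: "'n list" by (induction "is") (auto simp: *)
  ultimately show ?thesis by (simp add: C_space_def *)
qed

text \<open>The mean value theorem is applied on the straight segment, whatever curve leads to
  \<open>z\<close>. The sum of the coordinate displacements is dual to the maximum in
  \<open>gradient_norm\<close>.\<close>

lemma increment_le_gradient_norm:
  fixes g :: "real ^ 'n::finite \<Rightarrow> real"
  assumes g: "g \<in> C_space 1"
  shows "\<bar>g z - g x\<bar> \<le> gradient_norm g * (\<Sum>i\<in>UNIV. \<bar>z $ i - x $ i\<bar>)"
proof -
  let ?c = "\<lambda>t. x + t *\<^sub>R (z - x)"
  have "((\<lambda>t. g (?c t)) has_real_derivative (\<Sum>i\<in>UNIV. (z $ i - x $ i) * partial_deriv i g (?c t))) (at t)" for t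
    by (rule has_real_derivative_along_curve[where f = g and z = ?c])
       (auto intro!: derivative_eq_intros C_space_1D(2)[OF g])
  from MVT2[OF zero_less_one this] obtain t where
    "g z - g x = (\<Sum>i\<in>UNIV. (z $ i - x $ i) * partial_deriv i g (?c t))" by auto
  also have "\<bar>\<dots>\<bar> \<le> (\<Sum>i\<in>UNIV. \<bar>(z $ i - x $ i) * partial_deriv i g (?c t)\<bar>)"
    by (rule sum_abs)
  also have "\<dots> \<le> (\<Sum>i\<in>UNIV. \<bar>z $ i - x $ i\<bar> * gradient_norm g)"
    unfolding abs_mult
    by (intro sum_mono mult_left_mono abs_partial_deriv_le_gradient_norm g) auto
  finally show ?thesis by (simp add: sum_distrib_left mult.commute)
qed

definition approx_error :: "(real ^ 'n::finite \<Rightarrow> real) \<Rightarrow> (real ^ 'n \<Rightarrow> real) \<Rightarrow> real" where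
  "approx_error F g = sup_norm (\<lambda>x. F x - g x)"

lemma bounded_diff: "F \<in> C0 \<Longrightarrow> g \<in> C_space 1 \<Longrightarrow> bounded (range (\<lambda>x. F x - g x))"
  using bounded_minus_comp[of F UNIV g] C_space_1D(1)[of g] by (simp add: C0_def)

lemma approx_error_nonneg: "F \<in> C0 \<Longrightarrow> g \<in> C_space 1 \<Longrightarrow> 0 \<le> approx_error F g"
  unfolding approx_error_def by (rule sup_norm_nonneg[OF bounded_diff])

text \<open>The factor 2 arises from replacing \<open>F\<close> by \<open>g\<close> at both end
  points.\<close>

lemma increment_le_approx:
  assumes F: "F \<in> C0" and g: "g \<in> C_space 1"
  shows "\<bar>F z - F x\<bar> \<le> 2 * approx_error F g + gradient_norm g * (\<Sum>i\<in>UNIV. \<bar>z $ i - x $ i\<bar>)"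
  using abs_le_sup_norm[OF bounded_diff[OF F g], of z] abs_le_sup_norm[OF bounded_diff[OF F g], of x]
    increment_le_gradient_norm[OF g, of z x] unfolding approx_error_def by linarith

lemma K_functional_le:
  assumes "F \<in> C0" "g \<in> C_space 1" "0 \<le> \<epsilon>"
  shows "K_functional \<epsilon> F \<le> approx_error F g + \<epsilon> * gradient_norm g"
proof -
  have "bdd_below ((\<lambda>g. approx_error F g + \<epsilon> * gradient_norm g) ` C_space 1)"
    by (rule bdd_belowI[of _ 0])
       (use assms in \<open>auto intro!: add_nonneg_nonneg mult_nonneg_nonneg approx_error_nonneg gradient_norm_nonneg\<close>)
  then show ?thesis
    unfolding K_functional_def approx_error_def gradient_norm_def by (rule cINF_lower) fact
qed

lemma K_functional_greatest:
  assumes "\<And>g. g \<in> C_space 1 \<Longrightarrow> c \<le> approx_error F g + \<epsilon> * gradient_norm g"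
  shows "c \<le> K_functional \<epsilon> F"
  unfolding K_functional_def
  by (rule cINF_greatest)
     (use zero_in_C_space_1 assms in \<open>auto simp: approx_error_def gradient_norm_def\<close>)

lemma K_functional_nonneg: "F \<in> C0 \<Longrightarrow> 0 \<le> \<epsilon> \<Longrightarrow> 0 \<le> K_functional \<epsilon> F"
  by (rule K_functional_greatest)
     (auto intro!: add_nonneg_nonneg mult_nonneg_nonneg approx_error_nonneg gradient_norm_nonneg)

lemma K_functional_mono:
  assumes "F \<in> C0" "0 \<le> \<epsilon>" "\<epsilon> \<le> \<epsilon>'"
  shows "K_functional \<epsilon> F \<le> K_functional \<epsilon>' F"
proof (rule K_functional_greatest)
  fix g :: "real ^ 'a \<Rightarrow> real" assume g: "g \<in> C_space 1"
  have "\<epsilon> * gradient_norm g \<le> \<epsilon>' * gradient_norm g"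
    using assms gradient_norm_nonneg[OF g] by (simp add: mult_right_mono)
  then show "K_functional \<epsilon> F \<le> approx_error F g + \<epsilon>' * gradient_norm g"
    using K_functional_le[OF assms(1) g assms(2)] by linarith
qed

text \<open>An infimum of functions affine in \<open>\<epsilon>\<close> is concave.\<close>

lemma concave_on_K_functional:
  assumes F: "F \<in> C0"
  shows "concave_on {0..} (\<lambda>\<epsilon>. K_functional \<epsilon> F)"
  unfolding concave_on_iff
proof (intro conjI ballI allI impI)
  fix s t a b :: real
  assume st: "s \<in> {0..}" "t \<in> {0..}" and ab: "0 \<le> a" "0 \<le> b" "a + b = 1"
  show "a * K_functional s F + b * K_functional t F \<le> K_functional (a *\<^sub>R s + b *\<^sub>R t) F"
  proof (rule K_functional_greatest)
    fix g :: "real ^ 'a \<Rightarrow> real" assume g: "g \<in> C_space 1"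
    have "a * K_functional s F + b * K_functional t F
        \<le> a * (approx_error F g + s * gradient_norm g) + b * (approx_error F g + t * gradient_norm g)"
      using st ab by (intro add_mono mult_left_mono K_functional_le[OF F g]) auto
    also have "\<dots> = (a + b) * approx_error F g + (a *\<^sub>R s + b *\<^sub>R t) * gradient_norm g"
      by (simp add: algebra_simps)
    finally show "a * K_functional s F + b * K_functional t F
        \<le> approx_error F g + (a *\<^sub>R s + b *\<^sub>R t) * gradient_norm g"
      using ab by simp
  qed
qed simp

section \<open>Mean displacements and mean increments along a power curve\<close>

lemma has_integral_powr_increment:
  fixes L \<mu> a :: real
  assumes L: "0 < L" "0 < \<mu>" "0 \<le> a" "a \<le> 1"
  shows "((\<lambda>y. L * y powr (L - 1) * (1 - y powr \<mu>)) has_integral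
    (1 - a powr L) - L / (L + \<mu>) * (1 - a powr (L + \<mu>))) {a..1}"
proof -
  have 1: "((\<lambda>y. L * y powr (L - 1)) has_integral (1 - a powr L)) {a..1}"
    using has_integral_powr_density[of L a 1] assms by simp
  have 2: "((\<lambda>y. (L + \<mu>) * y powr (L + \<mu> - 1)) has_integral (1 - a powr (L + \<mu>))) {a..1}"
    using has_integral_powr_density[of "L + \<mu>" a 1] assms by simp
  \<comment> \<open>Multiplying the density with exponent \<open>L\<close> by
    \<open>y powr \<mu>\<close> gives a multiple of the density with exponent
    \<open>L + \<mu>\<close>.\<close>
  have eq: "L * y powr (L - 1) - L / (L + \<mu>) * ((L + \<mu>) * y powr (L + \<mu> - 1))
      = L * y powr (L - 1) * (1 - y powr \<mu>)" for y
  proof -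
    have "y powr (L + \<mu> - 1) = y powr (L - 1) * y powr \<mu>"
      by (simp add: algebra_simps flip: powr_add)
    then show ?thesis using L by (simp add: field_simps)
  qed
  show ?thesis
    using has_integral_diff[OF 1 has_integral_mult_right[OF 2, of "L / (L + \<mu>)"]] unfolding eq .
qed

lemma powr_inverse_exponent: "0 < L \<Longrightarrow> (2 powr (- 1 / L)) powr L = 1 / (2::real)"
proof -
  assume "0 < L"
  have "(2 powr (- 1 / L)) powr L = 2 powr (- 1 / L * L :: real)" by (rule powr_powr)
  also have "- 1 / L * L = - 1" using \<open>0 < L\<close> by simp
  finally show ?thesis by (simp add: powr_minus)
qed

text \<open>The cut \<open>a\<close> is the median of the probability density \<open>L * y powr (L - 1)\<close> on the unit interval.\<close>

lemma upper_half_powr_increment_le: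
  fixes L \<mu> :: real
  assumes L: "0 < L" "0 < \<mu>"
  defines "a \<equiv> 2 powr (- 1 / L)"
  shows "(1 - a powr L) - L / (L + \<mu>) * (1 - a powr (L + \<mu>)) \<le> \<mu> / (2 * (2 * L + \<mu>))"
proof -
  \<comment> \<open>Both sides depend on the ratio \<open>s\<close> alone, and the claim reduces to
    1 + s / 2 \<le> 2 powr s, a consequence of ln 2 \<ge> 1 / 2.\<close>
  define s where "s = \<mu> / L"
  have s: "s > 0" using L by (simp add: s_def)
  have 1: "a powr L = 1 / 2"
    unfolding a_def by (rule powr_inverse_exponent[OF L(1)])
  have 2: "a powr (L + \<mu>) = 1 / (2 * 2 powr s)"
  proof -
    have "a powr (L + \<mu>) = 2 powr (- 1 / L * (L + \<mu>))" unfolding a_def by (rule powr_powr)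
    also have "- 1 / L * (L + \<mu>) = - (1 + s)" using L by (simp add: s_def field_simps)
    also have "2 powr (- (1 + s)) = 1 / (2 * 2 powr s)"
      unfolding powr_minus_divide powr_add by simp
    finally show ?thesis .
  qed
  have 3: "L / (L + \<mu>) = 1 / (1 + s)" using L by (simp add: s_def field_simps)
  have ln2: "1 / 2 \<le> ln (2::real)" using ln2_ge_two_thirds by simp
  have "1 + s / 2 \<le> 1 + s * ln 2" using s ln2 by (simp add: field_simps)
  also have "\<dots> \<le> exp (s * ln 2)" by (rule exp_ge_add_one_self)
  also have "\<dots> = 2 powr s" by (simp add: powr_def)
  finally have "2 + s \<le> 2 * 2 powr s" by simp
  then have "1 / (2 * 2 powr s) \<le> 1 / (2 + s)" using s by (intro divide_left_mono) auto
  then have "1 / (1 + s) * (1 - 1 / (2 + s)) \<le> 1 / (1 + s) * (1 - 1 / (2 * 2 powr s))"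
    using s by (intro mult_left_mono) auto
  moreover have "1 / (1 + s) * (1 - 1 / (2 + s)) = 1 / (2 + s)"
    using s by (simp add: field_simps)
  moreover have "\<mu> / (2 * (2 * L + \<mu>)) = s / (2 * (2 + s))" using L by (simp add: s_def field_simps)
  moreover have "1 / 2 - 1 / (2 + s) = s / (2 * (2 + s))" using s by (simp add: field_simps)
  ultimately show ?thesis unfolding 1 2 3 by linarith
qed

text \<open>Each half of the mass receives its own competitor in the K-functional, and the mass 1 /
  2 cancels the factor 2 of \<open>increment_le_approx\<close>. The half nearer to \<open>x\<close>
  carries a displacement of at most 5 / 7 T out of a total of at most 2 T, which leads to the
  arguments 5 / 7 T and 9 / 7 T.\<close>

lemma weighted_increment_le_K_functional:
  fixes F :: "real ^ 'n::finite \<Rightarrow> real" and x u :: "real ^ 'n"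
  assumes F: "F \<in> C0" and L: "1 < L" and \<mu>: "\<And>i. 0 < \<mu> i" and T: "0 \<le> T"
    and lower: "(\<Sum>i\<in>UNIV. \<bar>u $ i - x $ i\<bar> * (\<mu> i / (2 * (2 * L + \<mu> i)))) \<le> 5 / 7 * T"
    and total: "(\<Sum>i\<in>UNIV. \<bar>u $ i - x $ i\<bar> * (\<mu> i / (L + \<mu> i))) \<le> 2 * T"
  shows "\<bar>integral {0..1} (\<lambda>y. L * y powr (L - 1) * (F (power_curve \<mu> x u y) - F x))\<bar>
    \<le> K_functional (5 / 7 * T) F + K_functional (9 / 7 * T) F"
proof -
  let ?z = "power_curve \<mu> x u"
  let ?w = "\<lambda>y. L * y powr (L - 1)"
  let ?I = "integral {0..1} (\<lambda>y. ?w y * (F (?z y) - F x))"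
  define d where "d = (\<lambda>i. \<bar>u $ i - x $ i\<bar>)"
  define D where "D = (\<lambda>y. \<Sum>i\<in>UNIV. d i * (1 - y powr \<mu> i))"
  define a where "a = 2 powr (- 1 / L)"
  \<comment> \<open>\<open>J b\<close> is the weighted displacement over \<open>{b..1}\<close>: the
    total for \<open>b = 0\<close>, the part of the half nearer to \<open>x\<close> for
    \<open>b = a\<close>.\<close>
  define J where "J = (\<lambda>b. \<Sum>i\<in>UNIV. d i * ((1 - b powr L) - L / (L + \<mu> i) * (1 - b powr (L + \<mu> i))))"
  have a: "0 \<le> a" "a \<le> 1" "a powr L = 1 / 2"
  proof -
    have "2 powr (- 1 / L) \<le> 2 powr 0" using L by (intro powr_mono) auto
    then show "a \<le> 1" by (simp add: a_def)
    show "a powr L = 1 / 2" unfolding a_def by (rule powr_inverse_exponent) (use L in simp)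
  qed (simp add: a_def)
  have J: "((\<lambda>y. ?w y * D y) has_integral J b) {b..1}" if "0 \<le> b" "b \<le> 1" for b
  proof -
    have "((\<lambda>y. \<Sum>i\<in>UNIV. d i * (?w y * (1 - y powr \<mu> i))) has_integral J b) {b..1}"
      unfolding J_def using that L \<mu>
      by (intro has_integral_sum has_integral_mult_right has_integral_powr_increment) auto
    then show ?thesis by (simp add: D_def sum_distrib_left mult_ac)
  qed
  have J0: "J 0 \<le> 2 * T"
  proof -
    have "1 - L / (L + \<mu> i) = \<mu> i / (L + \<mu> i)" for i
      using L \<mu>[of i] by (simp add: field_simps)
    then show ?thesis using total by (simp add: J_def d_def)
  qed
  have Ja: "J a \<le> 5 / 7 * T"
  proof (rule order_trans[OF _ lower])
    show "J a \<le> (\<Sum>i\<in>UNIV. \<bar>u $ i - x $ i\<bar> * (\<mu> i / (2 * (2 * L + \<mu> i))))"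
      unfolding J_def d_def a_def
      by (intro sum_mono mult_left_mono upper_half_powr_increment_le \<mu>) (use L in auto)
  qed
  have lowJ: "((\<lambda>y. ?w y * D y) has_integral (J 0 - J a)) {0..a}"
  proof -
    have "(\<lambda>y. ?w y * D y) integrable_on {0..a}"
      by (rule integrable_subinterval_real[of _ 0 1]) (use J[of 0] a in auto)
    moreover have "integral {0..a} (\<lambda>y. ?w y * D y) + integral {a..1} (\<lambda>y. ?w y * D y) = integral {0..1} (\<lambda>y. ?w y * D y)"
      using J[of 0] a by (intro Henstock_Kurzweil_Integration.integral_combine) auto
    ultimately show ?thesis
      using J[of 0] J[of a] a by (simp add: has_integral_iff)
  qed
  have D: "\<bar>F (?z y) - F x\<bar> \<le> 2 * approx_error F g + gradient_norm g * D y"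
    if "g \<in> C_space 1" "y \<in> {0..1}" for g y
  proof -
    have "(\<Sum>i\<in>UNIV. \<bar>?z y $ i - x $ i\<bar>) = D y"
      unfolding D_def
    proof (rule sum.cong[OF refl])
      fix i
      have "?z y $ i - x $ i = (u $ i - x $ i) * (1 - y powr \<mu> i)" by (simp add: algebra_simps)
      moreover have "y powr \<mu> i \<le> 1" using that(2) \<mu>[of i] by (intro powr_le1) auto
      ultimately show "\<bar>?z y $ i - x $ i\<bar> = d i * (1 - y powr \<mu> i)"
        by (simp add: d_def abs_mult)
    qed
    then show ?thesis using increment_le_approx[OF F that(1), of "?z y" x] by simp
  qed
  have cont: "continuous_on {0..1} (\<lambda>y. ?w y * (F (?z y) - F x))"
    using F L
    by (intro continuous_intros continuous_on_powr_const continuous_on_compose_power_curve \<mu>)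
       (auto simp: C0_def uniformly_continuous_imp_continuous)
  then have int: "(\<lambda>y. ?w y * (F (?z y) - F x)) integrable_on {0..1}"
    by (rule integrable_continuous_interval)
  have bound: "\<bar>integral {b..c} (\<lambda>y. ?w y * (F (?z y) - F x))\<bar> \<le> 2 * approx_error F g * k + gradient_norm g * m"
    if g: "g \<in> C_space 1" and bc: "0 \<le> b" "c \<le> 1" and "(?w has_integral k) {b..c}"
      "((\<lambda>y. ?w y * D y) has_integral m) {b..c}" for b c k m g
  proof -
    have "((\<lambda>y. 2 * approx_error F g * ?w y + gradient_norm g * (?w y * D y)) has_integral
        (2 * approx_error F g * k + gradient_norm g * m)) {b..c}"
      by (intro has_integral_add has_integral_mult_right that)
    moreover have "(\<lambda>y. ?w y * (F (?z y) - F x)) integrable_on {b..c}"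
      by (rule integrable_subinterval_real[OF int]) (use bc in auto)
    moreover have "norm (?w y * (F (?z y) - F x)) \<le> 2 * approx_error F g * ?w y + gradient_norm g * (?w y * D y)"
      if "y \<in> {b..c}" for y
    proof -
      have "\<bar>?w y * (F (?z y) - F x)\<bar> \<le> ?w y * (2 * approx_error F g + gradient_norm g * D y)"
        unfolding abs_mult using L D[OF g, of y] that bc by (intro mult_mono) auto
      then show ?thesis by (simp add: algebra_simps)
    qed
    ultimately show ?thesis
      using integral_norm_bound_integral[of "\<lambda>y. ?w y * (F (?z y) - F x)" "{b..c}"
          "\<lambda>y. 2 * approx_error F g * ?w y + gradient_norm g * (?w y * D y)"]
      by (simp add: has_integral_iff)
  qed
  have two: "\<bar>?I\<bar> \<le> approx_error F g1 + approx_error F g2 + gradient_norm g1 * J a + gradient_norm g2 * (J 0 - J a)"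
    if g: "g1 \<in> C_space 1" "g2 \<in> C_space 1" for g1 g2
  proof -
    have "(?w has_integral 1 / 2) {a..1}" "(?w has_integral 1 / 2) {0..a}"
      using has_integral_powr_density[of L a 1] has_integral_powr_density[of L 0 a] a L by auto
    from bound[OF g(1) a(1) order_refl this(1) J[OF a(1,2)]] bound[OF g(2) order_refl a(2) this(2) lowJ]
    have "\<bar>integral {0..a} (\<lambda>y. ?w y * (F (?z y) - F x))\<bar> + \<bar>integral {a..1} (\<lambda>y. ?w y * (F (?z y) - F x))\<bar>
        \<le> approx_error F g1 + approx_error F g2 + gradient_norm g1 * J a + gradient_norm g2 * (J 0 - J a)"
      by simp
    moreover have "integral {0..a} (\<lambda>y. ?w y * (F (?z y) - F x)) + integral {a..1} (\<lambda>y. ?w y * (F (?z y) - F x)) = ?I"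
      using int a by (intro Henstock_Kurzweil_Integration.integral_combine) auto
    ultimately show ?thesis by linarith
  qed
  have affine: "\<bar>?I\<bar> \<le> (approx_error F g1 + 5 / 7 * T * gradient_norm g1) + (approx_error F g2 + 9 / 7 * T * gradient_norm g2)"
    if g: "g1 \<in> C_space 1" "g2 \<in> C_space 1" for g1 g2
  proof -
    let ?A1 = "approx_error F g1" and ?A2 = "approx_error F g2"
    let ?G1 = "gradient_norm g1" and ?G2 = "gradient_norm g2"
    have G: "0 \<le> ?G1" "0 \<le> ?G2" using g by (simp_all add: gradient_norm_nonneg)
    have one: "\<bar>?I\<bar> \<le> 2 * approx_error F g + 2 * T * gradient_norm g" if "g \<in> C_space 1" for g
    proof -
      have "gradient_norm g * J 0 \<le> gradient_norm g * (2 * T)"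
        by (rule mult_left_mono[OF J0 gradient_norm_nonneg[OF that]])
      with two[OF that that] show ?thesis by (simp add: algebra_simps)
    qed
    \<comment> \<open>The bounds on \<open>J a\<close> and \<open>J 0\<close> are both upper bounds
      and do not give \<open>J 0 - J a \<le> 9 / 7 * T\<close>. If \<open>?G2 \<le> ?G1\<close>, the
      gradient terms are regrouped as \<open>(?G1 - ?G2) * J a + ?G2 * J 0\<close>. Otherwise one
      competitor is used on both halves, and the two resulting bounds are averaged; this costs T (G1
      + G2), and shifting weight to the larger \<open>?G2\<close> only increases it.\<close>
    show ?thesis
    proof (cases "?G2 \<le> ?G1")
      case True
      have "(?G1 - ?G2) * J a \<le> (?G1 - ?G2) * (5 / 7 * T)" "?G2 * J 0 \<le> ?G2 * (2 * T)"
        by (rule mult_left_mono[OF Ja], use True in simp) (rule mult_left_mono[OF J0 G(2)])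
      then show ?thesis using two[OF g] by (simp add: algebra_simps)
    next
      case False
      then have "T * ?G1 \<le> T * ?G2" using T by (intro mult_left_mono) auto
      then show ?thesis using one[OF g(1)] one[OF g(2)] by (simp add: mult.assoc)
    qed
  qed
  \<comment> \<open>The infimum is taken over the first competitor with the second one fixed, and
    then over the second.\<close>
  have "\<bar>?I\<bar> - (approx_error F g + 9 / 7 * T * gradient_norm g) \<le> K_functional (5 / 7 * T) F"
    if "g \<in> C_space 1" for g
    by (rule K_functional_greatest) (use affine[OF _ that] in \<open>simp add: diff_le_eq\<close>)
  then have "\<bar>?I\<bar> - K_functional (5 / 7 * T) F \<le> K_functional (9 / 7 * T) F"
    by (intro K_functional_greatest) (simp add: diff_le_eq add.commute)
  then show ?thesis by linarith
qed

subsection \<open>The estimate\<close>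

lemma abs_prod_list_map: "\<bar>\<Prod>i\<leftarrow>is. g i\<bar> = (\<Prod>i\<leftarrow>is. \<bar>g i :: real\<bar>)"
  by (induction "is") (auto simp: abs_mult)

lemma concave_on_K_functional_scaled:
  assumes "F \<in> C0" "0 \<le> c"
  shows "concave_on {0..} (\<lambda>t. K_functional (c * t) F)"
  unfolding concave_on_iff
proof (intro conjI ballI allI impI)
  fix s t a b :: real
  assume "s \<in> {0..}" "t \<in> {0..}" "0 \<le> a" "0 \<le> b" "a + b = 1"
  then have "a * K_functional (c * s) F + b * K_functional (c * t) F \<le> K_functional (a *\<^sub>R (c * s) + b *\<^sub>R (c * t)) F"
    using concave_on_K_functional[OF assms(1)] assms(2) unfolding concave_on_iff by auto
  then show "a * K_functional (c * s) F + b * K_functional (c * t) F \<le> K_functional (c * (a *\<^sub>R s + b *\<^sub>R t)) F"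
    by (simp add: algebra_simps)
qed simp

theorem lemma1:
  fixes f :: "real ^ 'n::{finite,linorder} \<Rightarrow> real" and x u :: "real ^ 'n::{finite,linorder}" and r :: nat
  assumes "r \<ge> 1"
    and "f \<in> C_space r"
  shows "\<bar>taylor_remainder r f x u\<bar> \<le>
    2 / fact r *
      (\<Sum>is | length is = r.
         \<bar>u $ (is ! 0) - x $ (is ! 0)\<bar> ^ r *
         K_functional (real CARD('n) / (2 * (real r + 1)) * \<bar>u $ (is ! 0) - x $ (is ! 0)\<bar>)
           (iter_partial is f))"
proof -
  have f: "times_cont_diff r f" and F: "\<And>is. length is = r \<Longrightarrow> iter_partial is f \<in> C0"
    using assms(2) by (auto simp: C_space_def)
  define d where "d = (\<lambda>i. \<bar>u $ i - x $ i\<bar>)"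
  \<comment> \<open>The summand 1 makes \<open>S\<close> exceed every \<open>d i\<close>, hence
    every exponent exceeds 1; the common scale \<open>S\<close> drops out of the rates.\<close>
  define S where "S = 1 + (\<Sum>i\<in>UNIV. d i)"
  \<comment> \<open>A coordinate with \<open>d i = 0\<close> does not move along the curve, so 2
    stands for an arbitrary exponent above 1.\<close>
  define \<mu> where "\<mu> = (\<lambda>i. if d i = 0 then 2 else (S / d i) powr (1 + 1 / real r))"
  define c where "c = real CARD('n) / (2 * (real r + 1))"
  have c: "0 \<le> c" by (simp add: c_def)
  have d: "0 \<le> d i" "d i < S" for i
    using member_le_sum[of i UNIV d] by (auto simp: d_def S_def less_le_trans[OF _ add_left_mono])
  have \<mu>: "1 < \<mu> i" for i
  proof (cases "d i = 0")
    case False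
    then have "1 < S / d i" using d[of i] by simp
    then show ?thesis using False assms(1) by (simp add: \<mu>_def add_pos_pos)
  qed (simp add: \<mu>_def)
  let ?L = "\<lambda>is. \<Sum>i\<leftarrow>is. \<mu> i" and ?F = "\<lambda>is. iter_partial is f"
  let ?I = "\<lambda>is. integral {0..1} (\<lambda>y. ?L is * y powr (?L is - 1) * (?F is (power_curve \<mu> x u y) - ?F is x))"
  let ?W = "\<lambda>i is. d i ^ r * K_functional (c * d i) (?F is)"
  \<comment> \<open>The bound for a single tuple is symmetric in its positions, as the geometric
    mean is; the first index is singled out only after summation over the tuples.\<close>
  have bound: "\<bar>(\<Prod>i\<leftarrow>is. u $ i - x $ i) * ?I is\<bar> \<le> 2 / real r * (\<Sum>j<r. ?W (is ! j) is)"
    if len: "length is = r" for "is"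
  proof (cases "\<forall>i\<in>set is. 0 < d i")
    case False
    then have "(\<Prod>i\<leftarrow>is. u $ i - x $ i) = 0"
      by (auto simp: d_def prod_list_zero_iff image_iff)
    moreover have "0 \<le> (\<Sum>j<r. ?W (is ! j) is)"
      using d c by (intro sum_nonneg mult_nonneg_nonneg K_functional_nonneg F[OF len]) auto
    ultimately show ?thesis by simp
  next
    case True
    define as where "as = map d is"
    define T where "T = c * geo_mean as"
    have as: "as \<noteq> []" "length as = r" "\<And>a. a \<in> set as \<Longrightarrow> 0 < a"
      using True len assms(1) by (auto simp: as_def)
    have L: "?L is = (\<Sum>a\<leftarrow>as. (S / a) powr (1 + 1 / real r))"
      unfolding as_def map_map using True by (intro arg_cong[of _ _ sum_list] map_cong) (auto simp: \<mu>_def)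
    have T: "0 \<le> T" using c geo_mean_pos[of as] by (simp add: T_def)
    \<comment> \<open>The value \<open>b = 2\<close> serves the half nearer to \<open>x\<close>,
      with \<open>two_powr_le_5_7\<close>, and \<open>b = 1\<close> serves the total displacement.
      Summing over the N coordinates produces \<open>c\<close>.\<close>
    have rate: "d i * (\<mu> i / (b * ?L is + \<mu> i)) \<le> b powr (- (real r / (real r + 1))) * geo_mean as / (real r + 1)"
      if "0 < b" for b i
    proof (cases "d i = 0")
      case True
      then show ?thesis using geo_mean_pos[of as] by (simp add: less_imp_le)
    next
      case False
      then have "0 < d i" "0 < S" using d[of i] by auto
      moreover have "\<mu> i = (S / d i) powr (1 + 1 / real r)" using False by (simp add: \<mu>_def)
      ultimately show ?thesis
        unfolding L using weighted_rate_le_geo_mean[OF as(1,3) _ _ that, of "d i" S] as(2) by simp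
    qed
    have "\<bar>?I is\<bar> \<le> K_functional (5 / 7 * T) (?F is) + K_functional (9 / 7 * T) (?F is)"
    proof (rule weighted_increment_le_K_functional[OF F[OF len]])
      show "1 < ?L is" by (rule one_less_sum_list) (use len assms(1) \<mu> in auto)
      show "0 < \<mu> i" for i using \<mu>[of i] by simp
      have "(\<Sum>i\<in>UNIV. d i * (\<mu> i / (2 * (2 * ?L is + \<mu> i)))) \<le> (\<Sum>i\<in>(UNIV :: 'n set). 5 / 7 * geo_mean as / (2 * (real r + 1)))"
      proof (rule sum_mono)
        fix i
        have "d i * (\<mu> i / (2 * (2 * ?L is + \<mu> i))) = d i * (\<mu> i / (2 * ?L is + \<mu> i)) / 2" by simp
        also have "\<dots> \<le> 2 powr (- (real r / (real r + 1))) * geo_mean as / (real r + 1) / 2"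
          by (intro divide_right_mono rate) auto
        also have "\<dots> \<le> 5 / 7 * geo_mean as / (real r + 1) / 2"
          using assms(1) geo_mean_pos[of as]
          by (intro divide_right_mono mult_right_mono two_powr_le_5_7) auto
        finally show "d i * (\<mu> i / (2 * (2 * ?L is + \<mu> i))) \<le> 5 / 7 * geo_mean as / (2 * (real r + 1))"
          by (simp add: mult.commute)
      qed
      also have "\<dots> = 5 / 7 * T" by (simp add: T_def c_def)
      finally show "(\<Sum>i\<in>UNIV. \<bar>u $ i - x $ i\<bar> * (\<mu> i / (2 * (2 * ?L is + \<mu> i)))) \<le> 5 / 7 * T"
        by (simp add: d_def)
      have "(\<Sum>i\<in>UNIV. d i * (\<mu> i / (?L is + \<mu> i))) \<le> (\<Sum>i\<in>(UNIV :: 'n set). geo_mean as / (real r + 1))"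
        using rate[of 1] by (intro sum_mono) simp
      also have "\<dots> = 2 * T" by (simp add: T_def c_def field_simps)
      finally show "(\<Sum>i\<in>UNIV. \<bar>u $ i - x $ i\<bar> * (\<mu> i / (?L is + \<mu> i))) \<le> 2 * T"
        by (simp add: d_def)
    qed (rule T)
    moreover have "\<bar>\<Prod>i\<leftarrow>is. u $ i - x $ i\<bar> = geo_mean as ^ r"
      using geo_mean_power[OF as(1,3)] as(2) by (simp add: abs_prod_list_map as_def d_def)
    ultimately have "\<bar>(\<Prod>i\<leftarrow>is. u $ i - x $ i) * ?I is\<bar>
        \<le> geo_mean as ^ r * (K_functional (5 / 7 * T) (?F is) + K_functional (9 / 7 * T) (?F is))"
      unfolding abs_mult using geo_mean_pos[of as] by (simp add: mult_left_mono)
    also have "\<dots> = 2 / real r * (real r * (geo_mean as ^ r *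
        ((K_functional (c * (5 / 7 * geo_mean as)) (?F is) + K_functional (c * (9 / 7 * geo_mean as)) (?F is)) / 2)))"
      using assms(1) by (simp add: T_def mult.left_commute[of _ c])
    also have "\<dots> \<le> 2 / real r * (\<Sum>a\<leftarrow>as. a ^ r * K_functional (c * a) (?F is))"
    proof (rule mult_left_mono)
      show "real r * (geo_mean as ^ r *
          ((K_functional (c * (5 / 7 * geo_mean as)) (?F is) + K_functional (c * (9 / 7 * geo_mean as)) (?F is)) / 2))
        \<le> (\<Sum>a\<leftarrow>as. a ^ r * K_functional (c * a) (?F is))"
        using geo_mean_concave_le[OF concave_on_K_functional_scaled[OF F[OF len] c] _ _ as(1,3)] as(2)
          K_functional_nonneg[OF F[OF len], of 0] K_functional_mono[OF F[OF len]] c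
        by (simp add: mult_left_mono)
    qed simp
    also have "(\<Sum>a\<leftarrow>as. a ^ r * K_functional (c * a) (?F is)) = (\<Sum>j<r. ?W (is ! j) is)"
      by (simp add: as_def sum_list_sum_nth atLeast0LessThan len)
    finally show ?thesis .
  qed
  have "\<bar>taylor_remainder r f x u\<bar> = \<bar>\<Sum>is | length is = r. (\<Prod>i\<leftarrow>is. u $ i - x $ i) * ?I is\<bar> / fact r"
    unfolding taylor_remainder_integral[where \<mu> = \<mu>, OF assms(1) f \<mu>] by simp
  also have "\<dots> \<le> (\<Sum>is | length is = r. 2 / real r * (\<Sum>j<r. ?W (is ! j) is)) / fact r"
    by (intro divide_right_mono order_trans[OF sum_abs] sum_mono bound) auto
  also have "\<dots> = 2 / fact r * ((\<Sum>is | length is = r. \<Sum>j<r. ?W (is ! j) is) / real r)"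
    unfolding sum_distrib_left[symmetric] by simp
  \<comment> \<open>By symmetry of the derivatives every position contributes as much as the first,
    and the factor \<open>real r\<close> cancels the averaging in \<open>bound\<close>.\<close>
  also have "(\<Sum>is | length is = r. \<Sum>j<r. ?W (is ! j) is) = real r * (\<Sum>is | length is = r. ?W (is ! 0) is)"
  proof (rule sum_lists_nth_eq_first)
    fix "is" js :: "'n list" and i
    assume "mset is = mset js" "length is = r"
    then show "?W i is = ?W i js" using iter_partial_mset_cong[of "is" js f] f by simp
  qed
  finally show ?thesis
    using assms(1) by (simp add: d_def c_def)
qed

end
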